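(* Let $d\ge 1$, $a>0$, $\theta>0$, $A=a-1$, and $\bar D=\mathbb{R}^+\times\mathbb{R}^{d-1}$. For any fixed $x=(x_1,x')\in\bar D$, the family of probability measures $\rho^\varepsilon_x(\mathrm{d}y)=p_\varepsilon(x,\mathrm{d}y)$, $\varepsilon>0$, on $\bar D$ (the time-$\varepsilon$ transition kernel of sticky-reflected Brownian motion with boundary diffusion, see context) satisfies, as $\varepsilon\to0$, the Large Deviation Principle with speed $1/\varepsilon$ and good rate function $y\mapsto c(x,y)$, i.e. for every Borel set $E\subset\bar D$ $$-\inf_{y\in E^\circ}c(x,y)\le\liminf_{\varepsilon\to0}\varepsilon\log\rho^\varepsilon_x(E)\le\limsup_{\varepsilon\to0}\varepsilon\log\rho^\varepsilon_x(E)\le-\inf_{y\in\overline{E}}c(x,y),$$ where: if $a\le1$, $c(x,y)=\frac12|x-y|^2$ for all $x,y\in\bar D$; if $a>1$, $$c(x,y)=\frac12\begin{cases}|x-y|^2&\text{if }(x,y)\in\mathfrak C,\\ \frac1a\left(\sqrt{A}\,|x_1+y_1|+|y'-x'|\right)^2&\text{otherwise,}\end{cases}$$ with $$\mathfrak C=\left\{(x,y)\in\bar D^2:\ |y'-x'|\le\frac1{\sqrt A}\left[|x_1+y_1|+2\sqrt a\sqrt{x_1y_1}\right]\right\}.$$ Moreover $(x,y)\mapsto c(x,y)$ is symmetric and continuous over $\bar D^2$.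
   Context: Points of $\bar D=\mathbb{R}^+\times\mathbb{R}^{d-1}$ ($\mathbb{R}^+=[0,\infty)$, $\mathbb{R}^0=\{0\}$) are written $x=(x_1,x')$ with $x_1\ge0$, $x'\in\mathbb{R}^{d-1}$. Interior $E^\circ$ and closure $\overline E$ are taken in the topology of $\bar D$. A good rate function is a lower semicontinuous function with values in $[0,\infty]$ and compact sublevel sets. Sticky-reflected Brownian motion with boundary diffusion (SBM) in $\bar D$, with tangential diffusivity $a>0$ and stickiness $\theta>0$, is the $\bar D$-valued process $X_t=(X^1_t,X'_t)$ given as the (unique in law) weak solution of $$\mathrm{d}X^1_t=\mathbf 1_{\{X^1_t>0\}}\mathrm{d}B^1_t+\theta\mathbf 1_{\{X^1_t=0\}}\mathrm{d}t,\qquad \mathrm{d}X'_t=\left[\sqrt a\,\mathbf 1_{\{X^1_t=0\}}+\mathbf 1_{\{X^1_t>0\}}\right]\mathrm{d}B'_t,\qquad X_0=x,$$ with $B=(B^1,B')$ a standard $d$-dimensional Brownian motion. Its transition kernel is given explicitly by $$p_t(x,\mathrm{d}y)=\left[g^0_t(x_1,y_1)\,g(t,y'-x')+2\int_0^{\theta t}h\left(t-\tfrac l\theta,\,l+x_1+y_1\right)g\left(t+A\tfrac l\theta,\,y'-x'\right)\mathrm{d}l\right]\mu(\mathrm{d}y),$$ where $A=a-1$, $\mu(\mathrm{d}y)=\left(\mathrm{d}y_1+\frac1{2\theta}\delta_0(\mathrm{d}y_1)\right)\mathrm{d}y'$, and $$g^0_t(x_1,z)=\frac1{\sqrt{2\pi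 t}}\left[e^{-|x_1-z|^2/(2t)}-e^{-|x_1+z|^2/(2t)}\right],\quad h(t,r)=\frac{|r|}{\sqrt{2\pi}\,t^{3/2}}e^{-r^2/(2t)},\quad g(t,z')=\frac1{(2\pi t)^{(d-1)/2}}e^{-|z'|^2/(2t)}.$$ *)

theory Defs
  imports "HOL-Probability.Probability"
begin

text \<open>
  The ambient space \<open>R^d\<close>, \<open>d \<ge> 1\<close>, is \<^typ>\<open>real ^ 'd\<close> with \<open>d = CARD('d)\<close>; an arbitrary index \<open>i\<close>
  plays the role of the first coordinate.  The tangential part \<open>x'\<close> is represented by the vector
  \<open>tang i x\<close> of \<open>R^d\<close> whose \<open>i\<close>-th coordinate is \<open>0\<close>, so that \<open>norm (tang i x)\<close> is the Euclidean
  norm of \<open>x'\<close> in \<open>R^(d-1)\<close>; for \<open>d = 1\<close> it is always \<open>0\<close>.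
\<close>

definition half_space :: "'d::finite \<Rightarrow> (real ^ 'd) set" where
  "half_space i = {x. 0 \<le> x $ i}"

definition tang :: "'d::finite \<Rightarrow> real ^ 'd \<Rightarrow> real ^ 'd" where
  "tang i x = (\<chi> j. if j = i then 0 else x $ j)"

definition g0 :: "real \<Rightarrow> real \<Rightarrow> real \<Rightarrow> real" where
  "g0 t x1 z = 1 / sqrt (2 * pi * t) *
     (exp (- (\<bar>x1 - z\<bar>\<^sup>2 / (2 * t))) - exp (- (\<bar>x1 + z\<bar>\<^sup>2 / (2 * t))))"

definition hit_density :: "real \<Rightarrow> real \<Rightarrow> real" where
  "hit_density t r = \<bar>r\<bar> / (sqrt (2 * pi) * t powr (3 / 2)) * exp (- (r\<^sup>2 / (2 * t)))"

text \<open>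
  The heat kernel of \<open>R^(d-1)\<close> (hence the exponent \<open>(d-1)/2\<close>), to be applied to tangential vectors
  of \<^typ>\<open>real ^ 'd\<close>.
\<close>

definition gauss_tang :: "real \<Rightarrow> real ^ 'd::finite \<Rightarrow> real" where
  "gauss_tang t z = 1 / (2 * pi * t) powr ((real CARD('d) - 1) / 2) *
     exp (- ((norm z)\<^sup>2 / (2 * t)))"

text \<open>\<open>dy\<^sub>1 + \<delta>\<^sub>0(dy\<^sub>1) / (2 \<theta>)\<close> on \<open>[0, \<infinity>)\<close>, as a measure on the Borel sets of the whole line.\<close>

definition sticky_line :: "real \<Rightarrow> real measure" where
  "sticky_line \<theta> = measure_of UNIV (sets borel)
     (\<lambda>B. emeasure lborel (B \<inter> {0..}) + ennreal (1 / (2 * \<theta>)) * indicator B 0)"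

text \<open>
  \<open>\<mu>(dy) = (dy\<^sub>1 + \<delta>\<^sub>0(dy\<^sub>1) / (2 \<theta>)) dy'\<close>: the product over all coordinates, transported from
  functions to vectors and restricted to the closed half-space.
\<close>

definition sticky_measure :: "'d::finite \<Rightarrow> real \<Rightarrow> (real ^ 'd) measure" where
  "sticky_measure i \<theta> = restrict_space
     (distr (Pi\<^sub>M UNIV (\<lambda>j. if j = i then sticky_line \<theta> else lborel)) borel (\<lambda>f. \<chi> j. f j))
     (half_space i)"

definition sbm_density :: "'d::finite \<Rightarrow> real \<Rightarrow> real \<Rightarrow> real \<Rightarrow> real ^ 'd \<Rightarrow> real ^ 'd \<Rightarrow> real" where
  "sbm_density i a \<theta> t x y =
     g0 t (x $ i) (y $ i) * gauss_tang t (tang i y - tang i x) +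
     2 * (LBINT l:{0..\<theta> * t}. hit_density (t - l / \<theta>) (l + x $ i + y $ i) *
            gauss_tang (t + (a - 1) * (l / \<theta>)) (tang i y - tang i x))"

definition sbm_kernel :: "'d::finite \<Rightarrow> real \<Rightarrow> real \<Rightarrow> real \<Rightarrow> real ^ 'd \<Rightarrow> (real ^ 'd) measure" where
  "sbm_kernel i a \<theta> t x =
     density (sticky_measure i \<theta>) (\<lambda>y. ennreal (sbm_density i a \<theta> t x y))"

lemma sets_sticky_line [measurable_cong, simp]: "sets (sticky_line \<theta>) = sets borel"
  using sets.sigma_sets_eq[of "borel :: real measure"] by (simp add: sticky_line_def)

lemma space_sticky_line [simp]: "space (sticky_line \<theta>) = UNIV"
  by (simp add: sticky_line_def)

lemma emeasure_sticky_line: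
  assumes "B \<in> sets borel"
  shows "emeasure (sticky_line \<theta>) B =
    emeasure lborel (B \<inter> {0..}) + ennreal (1 / (2 * \<theta>)) * indicator B 0"
proof (rule emeasure_measure_of[OF sticky_line_def])
  show "countably_additive (sets (sticky_line \<theta>))
     (\<lambda>B. emeasure lborel (B \<inter> {0..}) + ennreal (1 / (2 * \<theta>)) * indicator B 0)"
  proof (rule countably_additiveI)
    fix F :: "nat \<Rightarrow> real set"
    assume F: "range F \<subseteq> sets (sticky_line \<theta>)" "disjoint_family F"
    have "(\<Sum>n. emeasure lborel (F n \<inter> {0..})) = emeasure lborel (\<Union>n. F n \<inter> {0..})"
      using F by (intro suminf_emeasure) (auto simp: disjoint_family_on_def)
    moreover have "(\<Union>n. F n \<inter> {0..}) = \<Union> (range F) \<inter> {0..}" by auto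
    moreover have "(\<Sum>n. indicator (F n) (0::real)) = (indicator (\<Union> (range F)) 0 :: ennreal)"
      using F by (intro suminf_indicator) auto
    ultimately show "(\<Sum>n. emeasure lborel (F n \<inter> {0..}) +
         ennreal (1 / (2 * \<theta>)) * indicator (F n) 0) =
       emeasure lborel (\<Union> (range F) \<inter> {0..}) +
         ennreal (1 / (2 * \<theta>)) * indicator (\<Union> (range F)) 0"
      by (simp flip: suminf_add)
  qed
qed (use assms in \<open>auto simp: positive_def\<close>)

lemma sets_sticky_measure:
  "sets (sticky_measure i \<theta>) = sets (restrict_space borel (half_space i))"
  by (simp add: sticky_measure_def sets_restrict_space)

definition good_rate_function :: "'a::topological_space set \<Rightarrow> ('a \<Rightarrow> ereal) \<Rightarrow> bool" where
  "good_rate_function D I \<longleftrightarrow>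
     (\<forall>y\<in>D. 0 \<le> I y) \<and>
     (\<forall>\<alpha>::ereal. openin (top_of_set D) {y \<in> D. \<alpha> < I y}) \<and>
     (\<forall>\<alpha>::real. compact {y \<in> D. I y \<le> ereal \<alpha>})"

definition elog :: "real \<Rightarrow> ereal" where
  "elog r = (if r \<le> 0 then - \<infinity> else ereal (ln r))"

text \<open>
  The large deviation principle on \<open>D\<close>, as \<open>\<epsilon> \<rightarrow> 0\<close> and with speed \<open>1/\<epsilon>\<close>.  Interior and closure are
  relative to \<open>D\<close>, and the infimum over the empty set is \<open>\<infinity>\<close>.
\<close>

definition LDP :: "'a::topological_space set \<Rightarrow> (real \<Rightarrow> 'a measure) \<Rightarrow> ('a \<Rightarrow> ereal) \<Rightarrow> bool" where
  "LDP D \<rho> I \<longleftrightarrow>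
     (\<forall>\<epsilon>>0. prob_space (\<rho> \<epsilon>) \<and> sets (\<rho> \<epsilon>) = sets (restrict_space borel D)) \<and>
     good_rate_function D I \<and>
     (\<forall>E \<in> sets (restrict_space borel D).
        - (INF y \<in> top_of_set D interior_of E. I y)
          \<le> Liminf (at_right 0) (\<lambda>\<epsilon>. ereal \<epsilon> * elog (measure (\<rho> \<epsilon>) E)) \<and>
        Liminf (at_right 0) (\<lambda>\<epsilon>. ereal \<epsilon> * elog (measure (\<rho> \<epsilon>) E))
          \<le> Limsup (at_right 0) (\<lambda>\<epsilon>. ereal \<epsilon> * elog (measure (\<rho> \<epsilon>) E)) \<and>
        Limsup (at_right 0) (\<lambda>\<epsilon>. ereal \<epsilon> * elog (measure (\<rho> \<epsilon>) E))
          \<le> - (INF y \<in> top_of_set D closure_of E. I y))"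

definition cost_cone :: "'d::finite \<Rightarrow> real \<Rightarrow> ((real ^ 'd) \<times> (real ^ 'd)) set" where
  "cost_cone i a = {(x, y). x \<in> half_space i \<and> y \<in> half_space i \<and>
     norm (tang i y - tang i x) \<le>
       1 / sqrt (a - 1) * (\<bar>x $ i + y $ i\<bar> + 2 * sqrt a * sqrt (x $ i * y $ i))}"

definition sbm_cost :: "'d::finite \<Rightarrow> real \<Rightarrow> real ^ 'd \<Rightarrow> real ^ 'd \<Rightarrow> real" where
  "sbm_cost i a x y =
     (if a \<le> 1 then 1 / 2 * (norm (x - y))\<^sup>2
      else 1 / 2 *
        (if (x, y) \<in> cost_cone i a then (norm (x - y))\<^sup>2
         else 1 / a * (sqrt (a - 1) * \<bar>x $ i + y $ i\<bar> + norm (tang i y - tang i x))\<^sup>2))"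

end

theory Submission
  imports Defs "HOL-Real_Asymp.Real_Asymp"
begin

text \<open>
  Write \<open>R = x\<^sub>1 + y\<^sub>1\<close> and \<open>z = y' - x'\<close>. The substitution \<open>l = \<theta> t \<tau>\<close> exhibits the two terms of the
  density at time \<open>t\<close> as having exponents \<open>|x - y|\<^sup>2 / (2 t)\<close> and, up to the negligible shift of \<open>R\<close> by
  \<open>l\<close>, \<open>(R\<^sup>2 / (1 - \<tau>) + |z|\<^sup>2 / (1 + (a - 1) \<tau>)) / (2 t)\<close> with \<open>0 < \<tau> < 1\<close>; the cost is the smaller of
  \<open>|x - y|\<^sup>2 / 2\<close> and the infimum over \<open>\<tau>\<close> of half the bracket, which the Cauchy--Schwarz inequality computes.

  For the upper bound, multiplying the density with stickiness \<open>\<theta>\<close> at time \<open>t\<close> by \<open>exp ((1 - k) c / t)\<close>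
  gives at most \<open>k\<^sup>-\<^sup>p\<close> times the density with stickiness \<open>k \<theta>\<close> at time \<open>t / k\<close>, for a fixed power \<open>p\<close>. Since
  the latter has mass at most one, this is an exponential moment bound, uniform in \<open>t\<close>, and Chebyshev's
  inequality followed by \<open>k \<rightarrow> 0\<close> applies to all sets at once, without exponential tightness. For the lower
  bound, the density is bounded below on a small box around a point with \<open>y\<^sub>1 > 0\<close>, using either the
  first term or a short range of \<open>l\<close> around a nearly optimal \<open>\<tau>\<close>.

  That the total mass is one amounts to the fact that the flux through the boundary is the derivative in
  \<open>l\<close> of \<open>2 \<Phi> ((l + x\<^sub>1) / sqrt (t - l / \<theta>))\<close>, where \<open>\<Phi>\<close> is the standard normal distribution function.
\<close>

subsection \<open>One-dimensional integrals\<close>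

text \<open>At the end points only limits of \<open>F\<close> are required, because the boundary
  flux integrated with it involves a time that vanishes at the right end. The sign of
  \<open>f\<close> supplies integrability.\<close>

lemma nn_integral_FTC_Ioo:
  fixes f F :: "real \<Rightarrow> real"
  assumes "a < b"
    and "\<And>x. a < x \<Longrightarrow> x < b \<Longrightarrow> DERIV F x :> f x"
    and "\<And>x. a < x \<Longrightarrow> x < b \<Longrightarrow> isCont f x"
    and "\<And>x. a < x \<Longrightarrow> x < b \<Longrightarrow> 0 \<le> f x"
    and "(F \<longlongrightarrow> A) (at_right a)" and "(F \<longlongrightarrow> B) (at_left b)"
  shows "(\<integral>\<^sup>+x. ennreal (f x) * indicator {a<..<b} x \<partial>lborel) = ennreal (B - A)"
proof -
  have *: "set_integrable lborel (einterval (ereal a) (ereal b)) f"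
    "(LBINT x=ereal a..ereal b. f x) = B - A"
    using interval_integral_FTC_nonneg[of "ereal a" "ereal b" F f A B] assms
    by (simp_all add: ereal_tendsto_simps)
  have "(\<integral>\<^sup>+x. ennreal (f x) * indicator {a<..<b} x \<partial>lborel)
      = (\<integral>\<^sup>+x. ennreal (indicator {a<..<b} x *\<^sub>R f x) \<partial>lborel)"
    by (intro nn_integral_cong) (auto split: split_indicator)
  also have "\<dots> = ennreal (LBINT x:{a<..<b}. f x)"
    using *(1) assms(4) unfolding set_lebesgue_integral_def set_integrable_def
    by (intro nn_integral_eq_integral) (auto split: split_indicator)
  also have "(LBINT x:{a<..<b}. f x) = B - A"
    using *(2) assms(1) by (simp add: interval_lebesgue_integral_def)
  finally show ?thesis .
qed

section \<open>The standard normal distribution function\<close>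

definition std_normal_cdf :: "real \<Rightarrow> real" where
  "std_normal_cdf = cdf std_normal_distribution"

text \<open>A continuous density has some antiderivative \<open>F\<close>, and the fundamental
  theorem gives \<open>F\<close> and the distribution function the same increments, so they differ
  by a constant.\<close>

lemma DERIV_std_normal_cdf:
  "(std_normal_cdf has_real_derivative std_normal_density u) (at u)"
proof -
  interpret real_distribution std_normal_distribution by (rule real_dist_normal_dist)
  have cont: "isCont std_normal_density x" for x
    by (auto simp: normal_density_def[abs_def] intro!: continuous_intros)
  have "\<exists>F. \<forall>x. - \<infinity> < ereal x \<longrightarrow> ereal x < \<infinity> \<longrightarrow>
      (F has_vector_derivative std_normal_density x) (at x)"
    by (rule einterval_antiderivative[OF _ cont]) simp
  then obtain F where F: "(F has_vector_derivative std_normal_density x) (at x)" for x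
    by (metis MInfty_neq_ereal(1) PInfty_neq_ereal(1) ereal_infty_less(1) ereal_infty_less(2))
  have F': "(F has_real_derivative std_normal_density x) (at x)" for x
    using F by (simp add: has_real_derivative_iff_has_vector_derivative)
  have diff: "std_normal_cdf y - std_normal_cdf x = F y - F x" if "x < y" for x y
  proof -
    have "F x \<le> F y"
    proof (rule DERIV_nonneg_imp_nondecreasing[of x y F])
      show "\<exists>d. (F has_real_derivative d) (at u) \<and> 0 \<le> d" for u
        using F'[of u] normal_density_nonneg[of 0 1 u] by blast
    qed (use that in simp)
    have "emeasure std_normal_distribution {x<..y} =
       (\<integral>\<^sup>+v. ennreal (std_normal_density v) * indicator {x<..y} v \<partial>lborel)"
      by (simp add: emeasure_density)
    also have "\<dots> = (\<integral>\<^sup>+v. ennreal (std_normal_density v) * indicator {x..y} v \<partial>lborel)"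
      using AE_lborel_singleton[of x]
      by (intro nn_integral_cong_AE) (auto split: split_indicator elim!: eventually_mono)
    also have "\<dots> = ennreal (F y - F x)"
      using that F' by (intro nn_integral_FTC_Icc) auto
    finally show ?thesis
      using that \<open>F x \<le> F y\<close> by (simp add: std_normal_cdf_def cdf_diff_eq measure_def)
  qed
  have "std_normal_cdf v = F v + (std_normal_cdf u - F u)" for v
    using diff[of u v] diff[of v u] by (cases u v rule: linorder_cases) auto
  then have eq: "std_normal_cdf = (\<lambda>v. F v + (std_normal_cdf u - F u))" by (rule ext)
  show ?thesis
    by (subst eq) (auto intro!: derivative_eq_intros F')
qed

lemma DERIV_std_normal_cdf_chain [derivative_intros]:
  assumes "(g has_real_derivative g') (at x within s)"
  shows "((\<lambda>x. std_normal_cdf (g x)) has_real_derivative std_normal_density (g x) * g') (at x within s)"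
  using DERIV_chain2[OF DERIV_std_normal_cdf assms] .

lemma std_normal_cdf_at_top: "(std_normal_cdf \<longlongrightarrow> 1) at_top"
proof -
  interpret real_distribution std_normal_distribution by (rule real_dist_normal_dist)
  show ?thesis unfolding std_normal_cdf_def by (rule cdf_lim_at_top_prob)
qed

text \<open>The density is even, so the sum of the values at \<open>u\<close> and \<open>- u\<close>
  has derivative zero; its limit at infinity is 1.\<close>

lemma std_normal_cdf_minus: "std_normal_cdf (- u) = 1 - std_normal_cdf u"
proof -
  interpret real_distribution std_normal_distribution by (rule real_dist_normal_dist)
  define f where "f = (\<lambda>u. std_normal_cdf u + std_normal_cdf (- u))"
  have "(f has_real_derivative 0) (at v)" for v
    unfolding f_def by (auto intro!: derivative_eq_intros simp: normal_density_def)
  then have const: "f v = f u" for v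
    by (intro DERIV_isconst_all) auto
  have "(f \<longlongrightarrow> 1 + 0) at_top"
    unfolding f_def std_normal_cdf_def
    by (intro tendsto_add cdf_lim_at_top_prob filterlim_compose[OF cdf_lim_at_bot filterlim_uminus_at_bot_at_top])
  moreover have "f = (\<lambda>_. f u)" using const by auto
  ultimately have "((\<lambda>_. f u) \<longlongrightarrow> 1) (at_top :: real filter)" by simp
  then have "f u = 1" by (simp add: tendsto_const_iff)
  then show ?thesis by (simp add: f_def)
qed

lemma std_normal_cdf_bounds: "0 \<le> std_normal_cdf u" "std_normal_cdf u \<le> 1"
proof -
  interpret real_distribution std_normal_distribution by (rule real_dist_normal_dist)
  show "0 \<le> std_normal_cdf u" "std_normal_cdf u \<le> 1"
    using cdf_nonneg cdf_bounded_prob by (auto simp: std_normal_cdf_def)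
qed

lemma std_normal_cdf_mono: "u \<le> v \<Longrightarrow> std_normal_cdf u \<le> std_normal_cdf v"
proof -
  interpret real_distribution std_normal_distribution by (rule real_dist_normal_dist)
  show "u \<le> v \<Longrightarrow> ?thesis" using cdf_nondecreasing by (auto simp: std_normal_cdf_def)
qed

lemma std_normal_density_scaled:
  assumes "0 < t"
  shows "std_normal_density (u / sqrt t) / sqrt t = 1 / sqrt (2 * pi * t) * exp (- (u\<^sup>2 / (2 * t)))"
  using assms by (simp add: normal_density_def power_divide real_sqrt_mult)

section \<open>Sign, measurability and explicit integrals of the kernels\<close>

lemma g0_nonneg: "0 \<le> x \<Longrightarrow> 0 \<le> z \<Longrightarrow> 0 < t \<Longrightarrow> 0 \<le> g0 t x z"
proof -
  assume *: "0 \<le> x" "0 \<le> z" "0 < t"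
  then have "\<bar>x - z\<bar>\<^sup>2 \<le> \<bar>x + z\<bar>\<^sup>2" by (intro power_mono) auto
  then show ?thesis using * by (simp add: g0_def divide_right_mono)
qed

text \<open>The killed heat kernel vanishes on the boundary, so the atom of the sticky measure
  receives nothing from the first term of the density.\<close>

lemma g0_at_0 [simp]: "g0 t x 0 = 0"
  by (simp add: g0_def)

lemma hit_density_nonneg: "0 \<le> hit_density t r"
  by (simp add: hit_density_def)

lemma gauss_tang_nonneg: "0 \<le> gauss_tang t z"
  by (simp add: gauss_tang_def)

lemma measurable_g0 [measurable]: "case_prod (g0 t) \<in> borel_measurable (borel \<Otimes>\<^sub>M borel)"
  unfolding g0_def by measurable

lemma measurable_hit_density [measurable]:
  "case_prod hit_density \<in> borel_measurable (borel \<Otimes>\<^sub>M borel)"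
  unfolding hit_density_def by measurable

lemma measurable_vec_lambda:
  fixes f :: "'a \<Rightarrow> 'd::finite \<Rightarrow> real"
  assumes "\<And>j. (\<lambda>x. f x j) \<in> borel_measurable M"
  shows "(\<lambda>x. \<chi> j. f x j) \<in> borel_measurable M"
proof (subst borel_measurable_euclidean_space, intro ballI)
  fix b :: "real ^ 'd" assume "b \<in> Basis"
  then obtain k where "b = axis k 1" by (auto simp: Basis_vec_def)
  then show "(\<lambda>x. (\<chi> j. f x j) \<bullet> b) \<in> borel_measurable M"
    using assms[of k] by (simp add: inner_axis)
qed

lemma continuous_on_tang [continuous_intros]:
  "continuous_on S f \<Longrightarrow> continuous_on S (\<lambda>x. tang i (f x))"
  unfolding tang_def
proof (rule continuous_on_vec_lambda)
  fix j assume "continuous_on S f"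
  then show "continuous_on S (\<lambda>x. if j = i then 0 else f x $ j)"
    by (cases "j = i") (auto intro: continuous_on_component)
qed

lemma measurable_tang [measurable]: "tang i \<in> borel_measurable borel"
  by (intro borel_measurable_continuous_onI continuous_intros)

lemma measurable_gauss_tang [measurable]:
  "case_prod gauss_tang \<in> borel_measurable (borel \<Otimes>\<^sub>M borel)"
  unfolding gauss_tang_def by measurable

text \<open>This is the probability that a one-dimensional Brownian motion from \<open>x\<close> has
  not hit 0 by time \<open>t\<close>. The reflection principle appears as the difference of two
  shifted distribution functions in \<open>F\<close>.\<close>

lemma nn_integral_g0:
  assumes "0 \<le> x" "0 < t"
  shows "(\<integral>\<^sup>+y. ennreal (g0 t x y) * indicator {0..} (y::real) \<partial>lborel) =
    ennreal (2 * std_normal_cdf (x / sqrt t) - 1)"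
proof -
  define F where "F = (\<lambda>y. std_normal_cdf ((y - x) / sqrt t) - std_normal_cdf ((y + x) / sqrt t))"
  have "(\<integral>\<^sup>+y. ennreal (g0 t x y) * indicator {0..} (y::real) \<partial>lborel) = ennreal (0 - F 0)"
  proof (rule nn_integral_FTC_atLeast)
    show "g0 t x \<in> borel_measurable borel" by simp
    fix y :: real assume "0 \<le> y"
    then show "0 \<le> g0 t x y" using assms by (simp add: g0_nonneg)
    have "(F has_real_derivative (std_normal_density ((y - x) / sqrt t) / sqrt t
        - std_normal_density ((y + x) / sqrt t) / sqrt t)) (at y)"
      unfolding F_def using assms by (auto intro!: derivative_eq_intros simp: divide_inverse)
    also have "std_normal_density ((y - x) / sqrt t) / sqrt t
        - std_normal_density ((y + x) / sqrt t) / sqrt t = g0 t x y"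
      using assms by (simp add: std_normal_density_scaled g0_def power2_commute[of y]
          right_diff_distrib add.commute)
    finally show "(F has_real_derivative g0 t x y) (at y)" .
  next
    have "LIM y at_top. (y + c) / sqrt t :> at_top" for c
      using assms filterlim_tendsto_pos_mult_at_top[OF tendsto_const, of "1 / sqrt t" _ at_top,
        OF _ filterlim_tendsto_add_at_top[OF tendsto_const[of c] filterlim_ident]]
      by (simp add: add.commute)
    from this[of "- x"] this[of x] have "(F \<longlongrightarrow> 1 - 1) at_top"
      unfolding F_def by (intro tendsto_diff filterlim_compose[OF std_normal_cdf_at_top]) auto
    then show "(F \<longlongrightarrow> 0) at_top" by simp
  qed
  also have "0 - F 0 = 2 * std_normal_cdf (x / sqrt t) - 1"
    by (simp add: F_def std_normal_cdf_minus)
  finally show ?thesis .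
qed

text \<open>\<open>normal_density\<close> takes the standard deviation, so \<open>sqrt t\<close>
  makes \<open>t\<close> the variance.\<close>

abbreviation heat :: "real \<Rightarrow> real \<Rightarrow> real" where
  "heat t \<equiv> normal_density 0 (sqrt t)"

lemma heat_eq: "0 \<le> t \<Longrightarrow> heat t r = 1 / sqrt (2 * pi * t) * exp (- (r\<^sup>2 / (2 * t)))"
  by (simp add: normal_density_def)

text \<open>With \<open>DERIV_heat\<close> this identifies \<open>hit_density t\<close> as minus the
  derivative of the heat kernel in \<open>r\<close>, which makes its integral over the normal
  coordinate explicit.\<close>

lemma hit_density_eq_heat:
  assumes "0 < t" "0 \<le> r"
  shows "hit_density t r = r / t * heat t r"
proof -
  have "t powr (3 / 2) = t * sqrt t"
    using assms powr_add[of t 1 "1/2"] by (simp add: powr_half_sqrt)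
  then show ?thesis
    using assms by (simp add: hit_density_def heat_eq real_sqrt_mult)
qed

lemma DERIV_heat:
  assumes "0 < t"
  shows "(heat t has_real_derivative - (r / t * heat t r)) (at r)"
  unfolding normal_density_def using assms
  by (auto intro!: derivative_eq_intros simp: field_simps)

lemma tendsto_heat_at_top:
  assumes "0 < t"
  shows "(heat t \<longlongrightarrow> 0) at_top"
proof -
  have "LIM r at_top. r\<^sup>2 / (2 * t) :> at_top"
    using assms filterlim_tendsto_pos_mult_at_top[OF tendsto_const, of "1 / (2 * t)" _ at_top,
        OF _ filterlim_pow_at_top[OF _ filterlim_ident], of 2] by simp
  then have "((\<lambda>r. exp (- (r\<^sup>2 / (2 * t)))) \<longlongrightarrow> 0) at_top"
    by (intro filterlim_compose[OF exp_at_bot]) (simp add: filterlim_uminus_at_bot)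
  from tendsto_mult_left[OF this, of "1 / sqrt (2 * pi * t)"] show ?thesis
    using assms by (simp add: normal_density_def[abs_def])
qed

lemma nn_integral_hit_density:
  assumes "0 \<le> c" "0 < t"
  shows "(\<integral>\<^sup>+y. ennreal (hit_density t (c + y)) * indicator {0..} (y::real) \<partial>lborel) = ennreal (heat t c)"
proof -
  have "(\<integral>\<^sup>+y. ennreal (hit_density t (c + y)) * indicator {0..} (y::real) \<partial>lborel)
      = ennreal (0 - (- heat t (c + 0)))"
  proof (rule nn_integral_FTC_atLeast[where F = "\<lambda>y. - heat t (c + y)"])
    show "(\<lambda>y. hit_density t (c + y)) \<in> borel_measurable borel" by measurable
    show "0 \<le> hit_density t (c + y)" for y by (rule hit_density_nonneg)
    have "LIM y at_top. c + y :> at_top"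
      by (rule filterlim_tendsto_add_at_top[OF tendsto_const filterlim_ident])
    then show "((\<lambda>y. - heat t (c + y)) \<longlongrightarrow> 0) at_top"
      using tendsto_minus[OF filterlim_compose[OF tendsto_heat_at_top[OF \<open>0 < t\<close>]]] by force
    show "((\<lambda>y. - heat t (c + y)) has_real_derivative hit_density t (c + y)) (at y)"
      if "0 \<le> y" for y
      using assms that
      by (auto intro!: derivative_eq_intros DERIV_chain2[OF DERIV_heat] simp: hit_density_eq_heat)
  qed
  then show ?thesis by simp
qed

text \<open>For fixed \<open>l\<close> the heat term comes from the Lebesgue part of the sticky
  measure and the \<open>hit_density\<close> term from its atom. In the derivative of
  \<open>?F\<close> the numerator \<open>l + x\<close> produces the former and
  \<open>sqrt (t - l / \<theta>)\<close> the latter.\<close>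

lemma nn_integral_boundary_flux:
  assumes "0 \<le> x" "0 < t" "0 < \<theta>"
  shows "(\<integral>\<^sup>+l. ennreal (2 * heat (t - l / \<theta>) (l + x) + 1 / \<theta> * hit_density (t - l / \<theta>) (l + x))
      * indicator {0<..<\<theta> * t} l \<partial>lborel) = ennreal (2 - 2 * std_normal_cdf (x / sqrt t))"
proof (rule nn_integral_FTC_Ioo)
  let ?f = "\<lambda>l. 2 * heat (t - l / \<theta>) (l + x) + 1 / \<theta> * hit_density (t - l / \<theta>) (l + x)"
  let ?u = "\<lambda>l. (l + x) / sqrt (t - l / \<theta>)"
  let ?F = "\<lambda>l. 2 * std_normal_cdf (?u l)"
  show "0 < \<theta> * t" using assms by simp
  show "0 \<le> ?f l" for l
    using assms by (simp add: hit_density_nonneg normal_density_nonneg)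
  fix l :: real assume l: "0 < l" "l < \<theta> * t"
  define s where "s = t - l / \<theta>"
  have s: "0 < s" using l assms by (simp add: s_def field_simps)
  show "isCont ?f l"
    unfolding hit_density_def normal_density_def using s \<open>0 < \<theta>\<close>
    by (intro continuous_intros) (auto simp: s_def)
  have "(?F has_real_derivative 2 * (std_normal_density (?u l) *
        ((1 * sqrt s - (l + x) * (inverse (sqrt s) / 2 * (- (1 / \<theta>)))) / (sqrt s * sqrt s)))) (at l)"
    using s assms unfolding s_def
    by (auto intro!: derivative_eq_intros)
  also have "2 * (std_normal_density (?u l) *
        ((1 * sqrt s - (l + x) * (inverse (sqrt s) / 2 * (- (1 / \<theta>)))) / (sqrt s * sqrt s)))
      = 2 * (std_normal_density (?u l) / sqrt s) + (1 / \<theta>) * ((l + x) / s) * (std_normal_density (?u l) / sqrt s)"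
    using s assms by (simp add: field_simps)
  also have "\<dots> = ?f l"
    using s assms l by (simp add: std_normal_density_scaled hit_density_eq_heat heat_eq flip: s_def)
  finally show "(?F has_real_derivative ?f l) (at l)" .
next
  let ?u = "\<lambda>l. (l + x) / sqrt (t - l / \<theta>)"
  have "isCont (\<lambda>l. 2 * std_normal_cdf (?u l)) 0"
    using assms
    by (intro DERIV_isCont[of _ "2 * (std_normal_density (?u 0) *
        ((1 * sqrt t - (0 + x) * (inverse (sqrt t) / 2 * (- (1 / \<theta>)))) / (sqrt t * sqrt t)))"])
       (auto intro!: derivative_eq_intros)
  then show "((\<lambda>l. 2 * std_normal_cdf (?u l)) \<longlongrightarrow> 2 * std_normal_cdf (x / sqrt t)) (at_right 0)"
    by (auto simp: isCont_def intro: tendsto_mono[OF at_le])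
  have "isCont (\<lambda>l. sqrt (t - l / \<theta>)) (\<theta> * t)"
    using assms by (intro continuous_intros) auto
  then have "((\<lambda>l. sqrt (t - l / \<theta>)) \<longlongrightarrow> 0) (at_left (\<theta> * t))"
    using assms by (auto simp: isCont_def intro: tendsto_mono[OF at_le])
  moreover have "((\<lambda>l. l + x) \<longlongrightarrow> \<theta> * t + x) (at_left (\<theta> * t))"
    by (intro tendsto_intros)
  moreover have "\<forall>\<^sub>F l in at_left (\<theta> * t). 0 < sqrt (t - l / \<theta>)"
    using assms by (auto simp: eventually_at_filter field_simps)
  \<comment> \<open>The numerator tends to \<open>\<theta> * t + x\<close>, which is positive even
    for \<open>x = 0\<close>, while the denominator tends to 0 from above.\<close>
  ultimately have "filterlim ?u at_top (at_left (\<theta> * t))"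
    using assms by (intro LIM_at_top_divide[of _ "\<theta> * t + x"]) (auto simp: add_pos_nonneg)
  then show "((\<lambda>l. 2 * std_normal_cdf (?u l)) \<longlongrightarrow> 2) (at_left (\<theta> * t))"
    using tendsto_mult_left[OF filterlim_compose[OF std_normal_cdf_at_top], of ?u _ 2] by simp
qed

subsection \<open>The sticky measure\<close>

text \<open>\<open>sticky_line\<close> is specified by its values on sets, so the formula starts
  from indicators and passes through scaling, sums and monotone limits.\<close>

lemma nn_integral_sticky_line:
  assumes "f \<in> borel_measurable borel"
  shows "(\<integral>\<^sup>+y. f y \<partial>sticky_line \<theta>) =
    (\<integral>\<^sup>+y. f y * indicator {0..} y \<partial>lborel) + ennreal (1 / (2 * \<theta>)) * f 0"
  using assms
proof (induction rule: borel_measurable_induct)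
  case (cong f g)
  then show ?case by (simp cong: nn_integral_cong)
next
  case (set A)
  have "(\<integral>\<^sup>+y. indicator A y * indicator {0..} y \<partial>lborel) = (\<integral>\<^sup>+y. indicator (A \<inter> {0..}) y \<partial>lborel)"
    by (intro nn_integral_cong) (auto split: split_indicator)
  then show ?case using set by (simp add: emeasure_sticky_line)
next
  case (mult u c)
  then show ?case
    by (simp add: nn_integral_cmult distrib_left mult.assoc mult.left_commute[of _ c])
next
  case (add u v)
  then show ?case
    by (simp add: nn_integral_add distrib_left distrib_right algebra_simps)
next
  case (seq U)
  have "(\<integral>\<^sup>+y. (SUP i. U i y) \<partial>sticky_line \<theta>) = (SUP i. \<integral>\<^sup>+y. U i y \<partial>sticky_line \<theta>)"
    using seq by (intro nn_integral_monotone_convergence_SUP) auto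
  also have "\<dots> = (SUP i. (\<integral>\<^sup>+y. U i y * indicator {0..} y \<partial>lborel) + ennreal (1 / (2 * \<theta>)) * U i 0)"
    using seq by simp
  also have "\<dots> = (SUP i. (\<integral>\<^sup>+y. U i y * indicator {0..} y \<partial>lborel)) + (SUP i. ennreal (1 / (2 * \<theta>)) * U i 0)"
    using \<open>incseq U\<close>
    by (intro ennreal_SUP_add)
       (auto simp: incseq_def le_fun_def intro!: nn_integral_mono mult_right_mono mult_left_mono)
  also have "(SUP i. (\<integral>\<^sup>+y. U i y * indicator {0..} y \<partial>lborel)) = (\<integral>\<^sup>+y. (SUP i. U i y * indicator {0..} y) \<partial>lborel)"
    using seq by (intro nn_integral_monotone_convergence_SUP[symmetric])
        (auto simp: incseq_def le_fun_def intro!: mult_right_mono)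
  also have "\<dots> = (\<integral>\<^sup>+y. (SUP i. U i y) * indicator {0..} y \<partial>lborel)"
    by (simp add: SUP_mult_right_ennreal)
  also have "(SUP i. ennreal (1 / (2 * \<theta>)) * U i 0) = ennreal (1 / (2 * \<theta>)) * (SUP i. U i 0)"
    by (simp add: SUP_mult_left_ennreal)
  finally show ?case by (simp add: SUP_apply[abs_def] image_comp)
qed

text \<open>Sigma-finiteness is what the product measure and Tonelli's theorem ask of each
  factor.\<close>

lemma sigma_finite_sticky_line: "sigma_finite_measure (sticky_line \<theta>)"
proof
  have "emeasure (sticky_line \<theta>) {- real n..real n} \<noteq> \<infinity>" for n
  proof -
    have "emeasure lborel ({- real n..real n} \<inter> {0..}) \<le> emeasure lborel {- real n..real n}"
      by (intro emeasure_mono) auto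
    also have "\<dots> < \<infinity>" by simp
    finally show ?thesis by (simp add: emeasure_sticky_line ennreal_mult_eq_top_iff split: split_indicator)
  qed
  moreover have "(\<Union>n. {- real n..real n}) = UNIV"
  proof (intro equalityI subsetI)
    fix x :: real
    obtain n :: nat where "\<bar>x\<bar> \<le> real n" using real_arch_simple by blast
    then show "x \<in> (\<Union>n. {- real n..real n})" by (auto simp: abs_le_iff intro!: exI[of _ n])
  qed auto
  ultimately show "\<exists>A. countable A \<and> A \<subseteq> sets (sticky_line \<theta>) \<and> \<Union> A = space (sticky_line \<theta>) \<and>
      (\<forall>a\<in>A. emeasure (sticky_line \<theta>) a \<noteq> \<infinity>)"
    by (intro exI[of _ "range (\<lambda>n. {- real n..real n})"]) auto
qed

abbreviation sticky_factor :: "'d \<Rightarrow> real \<Rightarrow> 'd \<Rightarrow> real measure" where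
  "sticky_factor i \<theta> \<equiv> \<lambda>j. if j = i then sticky_line \<theta> else lborel"

lemma product_sigma_finite_sticky_factor: "product_sigma_finite (sticky_factor i \<theta>)"
  by (simp add: product_sigma_finite_def sigma_finite_sticky_line sigma_finite_lborel)

lemma half_space_borel [measurable]: "half_space i \<in> sets borel"
  unfolding half_space_def by measurable

lemma measurable_vec_lambda_sticky_factor [measurable]:
  fixes i :: "'d::finite"
  shows "(\<lambda>f. \<chi> j. f j) \<in> Pi\<^sub>M UNIV (sticky_factor i \<theta>) \<rightarrow>\<^sub>M borel"
proof (rule measurable_vec_lambda)
  fix j
  have "(\<lambda>f. f j) \<in> Pi\<^sub>M UNIV (sticky_factor i \<theta>) \<rightarrow>\<^sub>M sticky_factor i \<theta> j"
    by (rule measurable_component_singleton) simp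
  also have "measurable (Pi\<^sub>M UNIV (sticky_factor i \<theta>)) (sticky_factor i \<theta> j) =
      measurable (Pi\<^sub>M UNIV (sticky_factor i \<theta>)) (borel :: real measure)"
    by (intro measurable_cong_sets) auto
  finally show "(\<lambda>f. f j) \<in> borel_measurable (Pi\<^sub>M UNIV (sticky_factor i \<theta>))" .
qed

lemma nn_integral_sticky_measure:
  fixes i :: "'d::finite"
  assumes "f \<in> borel_measurable borel"
  shows "(\<integral>\<^sup>+y. f y \<partial>sticky_measure i \<theta>) =
    (\<integral>\<^sup>+w. f (\<chi> j. w j) * indicator {0..} (w i) \<partial>Pi\<^sub>M UNIV (sticky_factor i \<theta>))"
proof -
  have "(\<integral>\<^sup>+y. f y \<partial>sticky_measure i \<theta>) =
     (\<integral>\<^sup>+y. f y * indicator (half_space i) y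
        \<partial>distr (Pi\<^sub>M UNIV (sticky_factor i \<theta>)) borel (\<lambda>f. \<chi> j. f j))"
    unfolding sticky_measure_def by (intro nn_integral_restrict_space) simp
  also have "\<dots> = (\<integral>\<^sup>+w. f (\<chi> j. w j) * indicator (half_space i) (\<chi> j. w j)
      \<partial>Pi\<^sub>M UNIV (sticky_factor i \<theta>))"
    using assms by (intro nn_integral_distr) auto
  finally show ?thesis by (simp add: half_space_def indicator_def)
qed

lemma nn_integral_sticky_measure_prod:
  fixes i :: "'d::finite"
  assumes "\<And>j. f j \<in> borel_measurable (borel :: real measure)"
  shows "(\<integral>\<^sup>+y. (\<Prod>j\<in>UNIV. f j (y $ j)) \<partial>sticky_measure i \<theta>) =
    ((\<integral>\<^sup>+v. f i v * indicator {0..} v \<partial>lborel) + ennreal (1 / (2 * \<theta>)) * f i 0) *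
    (\<Prod>j\<in>UNIV - {i}. \<integral>\<^sup>+v. f j v \<partial>lborel)"
proof -
  interpret product_sigma_finite "sticky_factor i \<theta>" by (rule product_sigma_finite_sticky_factor)
  \<comment> \<open>The half-space constrains the coordinate \<open>i\<close> alone, so its
    indicator is absorbed into the \<open>i\<close>-th factor and the integrand stays a
    product.\<close>
  define g where "g = (\<lambda>j v. if j = i then f i v * indicator {0..} v else f j v)"
  have g[measurable]: "g j \<in> borel_measurable borel" for j
    using assms by (cases "j = i") (auto simp: g_def)
  have split: "(\<Prod>j\<in>UNIV. h j) = h i * (\<Prod>j\<in>UNIV - {i}. h j)" for h :: "'d \<Rightarrow> ennreal"
    by (rule prod.remove) auto
  have "(\<integral>\<^sup>+y. (\<Prod>j\<in>UNIV. f j (y $ j)) \<partial>sticky_measure i \<theta>) =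
     (\<integral>\<^sup>+w. (\<Prod>j\<in>UNIV. f j (w j)) * indicator {0..} (w i) \<partial>Pi\<^sub>M UNIV (sticky_factor i \<theta>))"
    using assms by (subst nn_integral_sticky_measure) (auto intro!: borel_measurable_prod)
  also have "\<dots> = (\<integral>\<^sup>+w. (\<Prod>j\<in>UNIV. g j (w j)) \<partial>Pi\<^sub>M UNIV (sticky_factor i \<theta>))"
    by (intro nn_integral_cong) (auto simp: split g_def mult_ac intro!: arg_cong2[where f = "(*)"] prod.cong)
  also have "\<dots> = (\<Prod>j\<in>UNIV. integral\<^sup>N (sticky_factor i \<theta> j) (g j))"
  proof (rule product_nn_integral_prod)
    show "g j \<in> borel_measurable (sticky_factor i \<theta> j)" for j
      by (cases "j = i") auto
  qed simp
  also have "\<dots> = (\<integral>\<^sup>+v. g i v \<partial>sticky_line \<theta>) * (\<Prod>j\<in>UNIV - {i}. \<integral>\<^sup>+v. f j v \<partial>lborel)"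
    by (auto simp: split g_def intro!: arg_cong2[where f = "(*)"] prod.cong)
  also have "(\<integral>\<^sup>+v. g i v \<partial>sticky_line \<theta>) =
      (\<integral>\<^sup>+v. g i v * indicator {0..} v \<partial>lborel) + ennreal (1 / (2 * \<theta>)) * g i 0"
    by (rule nn_integral_sticky_line) simp
  also have "\<dots> = (\<integral>\<^sup>+v. f i v * indicator {0..} v \<partial>lborel) + ennreal (1 / (2 * \<theta>)) * f i 0"
    by (intro arg_cong2[where f = "(+)"] nn_integral_cong) (auto simp: g_def split: split_indicator)
  finally show ?thesis .
qed

text \<open>Tonelli is applied on the product of the coordinate measures, whose sigma-finiteness is
  known, and carried over to the half-space.\<close>

lemma Fubini_sticky_measure:
  fixes i :: "'d::finite" and f :: "real ^ 'd \<Rightarrow> real \<Rightarrow> ennreal"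
  assumes [measurable]: "case_prod f \<in> borel_measurable (borel \<Otimes>\<^sub>M borel)"
  shows "(\<integral>\<^sup>+y. (\<integral>\<^sup>+l. f y l \<partial>lborel) \<partial>sticky_measure i \<theta>) =
    (\<integral>\<^sup>+l. (\<integral>\<^sup>+y. f y l \<partial>sticky_measure i \<theta>) \<partial>lborel)"
proof -
  interpret product_sigma_finite "sticky_factor i \<theta>" by (rule product_sigma_finite_sticky_factor)
  interpret P: sigma_finite_measure "Pi\<^sub>M UNIV (sticky_factor i \<theta>)" by (rule sigma_finite) simp
  interpret pair_sigma_finite "Pi\<^sub>M UNIV (sticky_factor i \<theta>)" "lborel :: real measure"
    by (simp add: pair_sigma_finite_def P.sigma_finite_measure_axioms sigma_finite_lborel)
  have [measurable]: "(\<lambda>w. w i) \<in> borel_measurable (Pi\<^sub>M UNIV (sticky_factor i \<theta>))"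
    using measurable_compose[OF measurable_vec_lambda_sticky_factor[of i \<theta>], of "\<lambda>y. y $ i" borel] by simp
  have "(\<integral>\<^sup>+y. (\<integral>\<^sup>+l. f y l \<partial>lborel) \<partial>sticky_measure i \<theta>) =
     (\<integral>\<^sup>+w. (\<integral>\<^sup>+l. f (\<chi> j. w j) l * indicator {0..} (w i) \<partial>lborel) \<partial>Pi\<^sub>M UNIV (sticky_factor i \<theta>))"
    by (subst nn_integral_sticky_measure) (auto simp: nn_integral_multc)
  also have "\<dots> = (\<integral>\<^sup>+l. (\<integral>\<^sup>+w. f (\<chi> j. w j) l * indicator {0..} (w i) \<partial>Pi\<^sub>M UNIV (sticky_factor i \<theta>)) \<partial>lborel)"
    by (rule Fubini'[symmetric]) measurable
  also have "\<dots> = (\<integral>\<^sup>+l. (\<integral>\<^sup>+y. f y l \<partial>sticky_measure i \<theta>) \<partial>lborel)"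
    by (intro nn_integral_cong, subst nn_integral_sticky_measure) auto
  finally show ?thesis .
qed

subsection \<open>The transition kernel\<close>

lemma norm_tang_diff: "(norm (tang i y - tang i x))\<^sup>2 = (\<Sum>j\<in>UNIV - {i}. (y $ j - x $ j)\<^sup>2)"
proof -
  have "(norm (tang i y - tang i x))\<^sup>2 = (\<Sum>j\<in>UNIV. ((tang i y - tang i x) $ j)\<^sup>2)"
    by (simp add: norm_vec_def L2_set_def sum_nonneg)
  also have "\<dots> = ((tang i y - tang i x) $ i)\<^sup>2 + (\<Sum>j\<in>UNIV - {i}. ((tang i y - tang i x) $ j)\<^sup>2)"
    by (rule sum.remove) auto
  also have "\<dots> = (\<Sum>j\<in>UNIV - {i}. (y $ j - x $ j)\<^sup>2)"
    by (auto simp: tang_def intro!: sum.cong)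
  finally show ?thesis .
qed

text \<open>\<open>tang i\<close> removes the coordinate \<open>i\<close>, leaving one Gaussian
  factor for each other coordinate; their number matches the exponent in the normalisation. In this
  form the kernel can be integrated coordinate by coordinate.\<close>

lemma gauss_tang_prod:
  assumes "0 < t"
  shows "gauss_tang t (tang i y - tang i x) = (\<Prod>j\<in>UNIV - {i}. normal_density (x $ j) (sqrt t) (y $ j))"
proof -
  let ?n = "CARD('a) - 1"
  have "0 < CARD('a)" by simp
  then have "(real CARD('a) - 1) / 2 = real ?n * (1 / 2)" by (simp add: of_nat_diff)
  then have "(2 * pi * t) powr ((real CARD('a) - 1) / 2) = ((2 * pi * t) powr (1 / 2)) powr real ?n"
    by (simp add: powr_powr mult.commute)
  also have "\<dots> = sqrt (2 * pi * t) ^ ?n"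
    using assms by (subst powr_realpow) (simp_all add: powr_half_sqrt)
  finally have 1: "1 / (2 * pi * t) powr ((real CARD('a) - 1) / 2) = (\<Prod>j\<in>UNIV - {i}. 1 / sqrt (2 * pi * t))"
    by (simp add: power_divide)
  have "exp (- ((norm (tang i y - tang i x))\<^sup>2 / (2 * t))) = exp (\<Sum>j\<in>UNIV - {i}. - ((y $ j - x $ j)\<^sup>2 / (2 * t)))"
    by (simp add: norm_tang_diff sum_divide_distrib sum_negf)
  also have "\<dots> = (\<Prod>j\<in>UNIV - {i}. exp (- ((y $ j - x $ j)\<^sup>2 / (2 * t))))"
    by (rule exp_sum) simp
  finally show ?thesis
    unfolding gauss_tang_def 1 using assms
    by (simp add: normal_density_def prod_dividef power_one_over)
qed

lemma nn_integral_normal_density: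
  assumes "0 < \<sigma>"
  shows "(\<integral>\<^sup>+v. ennreal (normal_density m \<sigma> v) \<partial>lborel) = 1"
  using assms by (simp add: nn_integral_eq_integral normal_density_nonneg)

text \<open>Each tangential factor has integral 1 at every positive time, so the mass is decided by
  the normal coordinate.\<close>

lemma nn_integral_sticky_gauss_tang:
  fixes u :: "real \<Rightarrow> ennreal"
  assumes [measurable]: "u \<in> borel_measurable borel" and "0 < t"
  shows "(\<integral>\<^sup>+y. u (y $ i) * ennreal (gauss_tang t (tang i y - tang i x)) \<partial>sticky_measure i \<theta>) =
    (\<integral>\<^sup>+v. u v * indicator {0..} v \<partial>lborel) + ennreal (1 / (2 * \<theta>)) * u 0"
proof -
  define f where "f = (\<lambda>j v. if j = i then u v else ennreal (normal_density (x $ j) (sqrt t) v))"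
  have split: "(\<Prod>j\<in>UNIV. h j) = h i * (\<Prod>j\<in>UNIV - {i}. h j)" for h :: "'a \<Rightarrow> ennreal"
    by (rule prod.remove) auto
  have f[measurable]: "f j \<in> borel_measurable borel" for j
    by (cases "j = i") (auto simp: f_def)
  have "u (y $ i) * ennreal (gauss_tang t (tang i y - tang i x)) = (\<Prod>j\<in>UNIV. f j (y $ j))" for y
    using assms
    by (auto simp: split f_def gauss_tang_prod prod_ennreal normal_density_nonneg
        intro!: arg_cong2[where f = "(*)"] prod.cong)
  then have "(\<integral>\<^sup>+y. u (y $ i) * ennreal (gauss_tang t (tang i y - tang i x)) \<partial>sticky_measure i \<theta>) =
      ((\<integral>\<^sup>+v. f i v * indicator {0..} v \<partial>lborel) + ennreal (1 / (2 * \<theta>)) * f i 0) *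
      (\<Prod>j\<in>UNIV - {i}. \<integral>\<^sup>+v. f j v \<partial>lborel)"
    by (simp add: nn_integral_sticky_measure_prod)
  also have "(\<Prod>j\<in>UNIV - {i}. \<integral>\<^sup>+v. f j v \<partial>lborel) = 1"
    using assms by (intro prod.neutral) (auto simp: f_def nn_integral_normal_density)
  finally show ?thesis by (simp add: f_def)
qed

text \<open>
  The density with its \<open>l\<close>-integral taken in \<open>[0, \<infinity>]\<close>. It agrees almost everywhere with
  \<open>sbm_density\<close>, whose integral would be \<open>0\<close> if it diverged, and spares all integrability proofs.
\<close>

definition sbm_nn_density :: "'d::finite \<Rightarrow> real \<Rightarrow> real \<Rightarrow> real \<Rightarrow> real ^ 'd \<Rightarrow> real ^ 'd \<Rightarrow> ennreal" where
  "sbm_nn_density i a \<theta> t x y =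
     ennreal (g0 t (x $ i) (y $ i) * gauss_tang t (tang i y - tang i x)) +
     2 * (\<integral>\<^sup>+l. ennreal (hit_density (t - l / \<theta>) (l + x $ i + y $ i) *
            gauss_tang (t + (a - 1) * (l / \<theta>)) (tang i y - tang i x)) * indicator {0..\<theta> * t} l \<partial>lborel)"

lemma measurable_vec_nth_compose [measurable (raw)]:
  fixes f :: "'a \<Rightarrow> real ^ 'd::finite"
  assumes "f \<in> borel_measurable M"
  shows "(\<lambda>x. f x $ i) \<in> borel_measurable M"
  by (rule measurable_compose[OF assms])
     (intro borel_measurable_continuous_onI continuous_on_component continuous_on_id)

lemma measurable_sbm_nn_integrand [measurable]:
  fixes i :: "'d::finite"
  shows "(\<lambda>(y, l). ennreal (hit_density (t - l / \<theta>) (l + x $ i + y $ i) *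
      gauss_tang (t + (a - 1) * (l / \<theta>)) (tang i y - tang i x)) * indicator {0..\<theta> * t} l)
    \<in> borel_measurable (borel \<Otimes>\<^sub>M borel)"
  by measurable

lemma measurable_sbm_nn_density [measurable]: "sbm_nn_density i a \<theta> t x \<in> borel_measurable borel"
proof -
  have "(\<lambda>y. \<integral>\<^sup>+l. ennreal (hit_density (t - l / \<theta>) (l + x $ i + y $ i) *
      gauss_tang (t + (a - 1) * (l / \<theta>)) (tang i y - tang i x)) * indicator {0..\<theta> * t} l \<partial>lborel)
    \<in> borel_measurable borel"
    using measurable_sbm_nn_integrand by (intro lborel.borel_measurable_nn_integral) simp
  then show ?thesis
    unfolding sbm_nn_density_def[abs_def] by measurable
qed

lemma measurable_sticky_measure:
  "f \<in> borel_measurable borel \<Longrightarrow> f \<in> borel_measurable (sticky_measure i \<theta>)"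
  unfolding sticky_measure_def by (intro measurable_restrict_space1) simp

text \<open>\<open>t + (a - 1) * s = (t - s) + a * s\<close>: time in the interior counts with
  variance rate 1, time \<open>s\<close> on the boundary with rate \<open>a\<close>.\<close>

lemma tangential_time_pos:
  fixes a t s :: real
  assumes "0 < a" "0 \<le> s" "s < t"
  shows "0 < t + (a - 1) * s"
proof -
  have "0 < (t - s) + a * s" using assms by (simp add: add_pos_nonneg)
  then show ?thesis by (simp add: algebra_simps)
qed

text \<open>The stickiness \<open>\<phi>\<close> of the reference measure is kept apart from the
  \<open>\<theta>\<close> of the kernel, because the upper bound integrates a density of stickiness
  \<open>k * \<theta>\<close> against the measure of stickiness \<open>\<theta>\<close>. After
  exchanging the integrals, each fixed \<open>l\<close> is a one-dimensional computation.\<close>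

lemma nn_integral_sbm_nn_density:
  fixes i :: "'d::finite"
  assumes "0 < a" "0 < \<theta>" "0 < t" "0 < \<phi>" "x \<in> half_space i"
  shows "(\<integral>\<^sup>+y. sbm_nn_density i a \<theta> t x y \<partial>sticky_measure i \<phi>) =
    ennreal (2 * std_normal_cdf (x $ i / sqrt t) - 1) +
    (\<integral>\<^sup>+l. ennreal (2 * heat (t - l / \<theta>) (l + x $ i) + 1 / \<phi> * hit_density (t - l / \<theta>) (l + x $ i))
      * indicator {0<..<\<theta> * t} l \<partial>lborel)"
proof -
  let ?x = "x $ i"
  have x: "0 \<le> ?x" using assms by (simp add: half_space_def)
  let ?G = "\<lambda>t y. gauss_tang t (tang i y - tang i x)"
  let ?h = "\<lambda>l y. hit_density (t - l / \<theta>) (l + ?x + y)"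
  let ?k = "\<lambda>l y. ennreal (?h l (y $ i) * ?G (t + (a - 1) * (l / \<theta>)) y) * indicator {0..\<theta> * t} l"
  have "(\<integral>\<^sup>+y. sbm_nn_density i a \<theta> t x y \<partial>sticky_measure i \<phi>) =
     (\<integral>\<^sup>+y. ennreal (g0 t ?x (y $ i) * ?G t y) \<partial>sticky_measure i \<phi>) +
     2 * (\<integral>\<^sup>+y. (\<integral>\<^sup>+l. ?k l y \<partial>lborel) \<partial>sticky_measure i \<phi>)"
    unfolding sbm_nn_density_def
  proof (subst nn_integral_add)
    have "(\<lambda>y. \<integral>\<^sup>+l. ?k l y \<partial>lborel) \<in> borel_measurable borel"
      using measurable_sbm_nn_integrand by (intro lborel.borel_measurable_nn_integral) simp
    then have k: "(\<lambda>y. \<integral>\<^sup>+l. ?k l y \<partial>lborel) \<in> borel_measurable (sticky_measure i \<phi>)"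
      by (rule measurable_sticky_measure)
    then show "(\<lambda>y. 2 * (\<integral>\<^sup>+l. ?k l y \<partial>lborel)) \<in> borel_measurable (sticky_measure i \<phi>)" by simp
    show "(\<lambda>y. ennreal (g0 t ?x (y $ i) * ?G t y)) \<in> borel_measurable (sticky_measure i \<phi>)"
      by (intro measurable_sticky_measure) measurable
    show "(\<integral>\<^sup>+y. ennreal (g0 t ?x (y $ i) * ?G t y) \<partial>sticky_measure i \<phi>) +
        (\<integral>\<^sup>+y. 2 * (\<integral>\<^sup>+l. ?k l y \<partial>lborel) \<partial>sticky_measure i \<phi>) =
      (\<integral>\<^sup>+y. ennreal (g0 t ?x (y $ i) * ?G t y) \<partial>sticky_measure i \<phi>) +
        2 * (\<integral>\<^sup>+y. (\<integral>\<^sup>+l. ?k l y \<partial>lborel) \<partial>sticky_measure i \<phi>)"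
      using k by (simp add: nn_integral_cmult)
  qed
  also have "(\<integral>\<^sup>+y. ennreal (g0 t ?x (y $ i) * ?G t y) \<partial>sticky_measure i \<phi>) =
      (\<integral>\<^sup>+y. ennreal (g0 t ?x (y $ i)) * ennreal (?G t y) \<partial>sticky_measure i \<phi>)"
    by (simp add: ennreal_mult'' gauss_tang_nonneg)
  also have "\<dots> = (\<integral>\<^sup>+v. ennreal (g0 t ?x v) * indicator {0..} v \<partial>lborel) + ennreal (1 / (2 * \<phi>)) * ennreal (g0 t ?x 0)"
    using assms by (intro nn_integral_sticky_gauss_tang) auto
  also have "\<dots> = ennreal (2 * std_normal_cdf (?x / sqrt t) - 1)"
    using assms x by (simp add: nn_integral_g0)
  also have "(\<integral>\<^sup>+y. (\<integral>\<^sup>+l. ?k l y \<partial>lborel) \<partial>sticky_measure i \<phi>) =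
      (\<integral>\<^sup>+l. (\<integral>\<^sup>+y. ?k l y \<partial>sticky_measure i \<phi>) \<partial>lborel)"
    using measurable_sbm_nn_integrand by (intro Fubini_sticky_measure) simp
  also have "\<dots> = (\<integral>\<^sup>+l. ennreal (heat (t - l / \<theta>) (l + ?x) + 1 / (2 * \<phi>) * hit_density (t - l / \<theta>) (l + ?x))
      * indicator {0<..<\<theta> * t} l \<partial>lborel)"
  \<comment> \<open>Removing the two end points, a null set, leaves those \<open>l\<close> for which
    \<open>t - l / \<theta>\<close> and the tangential time are both positive.\<close>
  proof (rule nn_integral_cong_AE)
    have *: "(\<integral>\<^sup>+y. ?k l y \<partial>sticky_measure i \<phi>) =
        ennreal (heat (t - l / \<theta>) (l + ?x) + 1 / (2 * \<phi>) * hit_density (t - l / \<theta>) (l + ?x))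
          * indicator {0<..<\<theta> * t} l" if "l \<noteq> 0" "l \<noteq> \<theta> * t" for l
    proof (cases "0 < l \<and> l < \<theta> * t")
      case True
      then have s: "0 < t - l / \<theta>" using assms by (simp add: field_simps)
      then have t: "0 < t + (a - 1) * (l / \<theta>)"
        using assms True by (intro tangential_time_pos) auto
      have "(\<integral>\<^sup>+y. ?k l y \<partial>sticky_measure i \<phi>) =
          (\<integral>\<^sup>+y. ennreal (?h l (y $ i)) * ennreal (?G (t + (a - 1) * (l / \<theta>)) y) \<partial>sticky_measure i \<phi>)"
        using True by (simp add: ennreal_mult'' gauss_tang_nonneg)
      also have "\<dots> = (\<integral>\<^sup>+v. ennreal (?h l v) * indicator {0..} v \<partial>lborel)
          + ennreal (1 / (2 * \<phi>)) * ennreal (?h l 0)"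
        using t by (intro nn_integral_sticky_gauss_tang) auto
      also have "\<dots> = ennreal (heat (t - l / \<theta>) (l + ?x)) + ennreal (1 / (2 * \<phi>) * ?h l 0)"
        using s True x assms ennreal_mult[of "1 / (2 * \<phi>)" "?h l 0"]
        by (simp add: nn_integral_hit_density hit_density_nonneg)
      also have "\<dots> = ennreal (heat (t - l / \<theta>) (l + ?x) + 1 / (2 * \<phi>) * ?h l 0)"
        using assms by (intro ennreal_plus[symmetric]) (auto simp: normal_density_nonneg hit_density_nonneg)
      finally show ?thesis using True by simp
    qed (use that in \<open>auto split: split_indicator\<close>)
    show "AE l in lborel. (\<integral>\<^sup>+y. ?k l y \<partial>sticky_measure i \<phi>) =
        ennreal (heat (t - l / \<theta>) (l + ?x) + 1 / (2 * \<phi>) * hit_density (t - l / \<theta>) (l + ?x))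
          * indicator {0<..<\<theta> * t} l"
      using AE_lborel_singleton[of 0] AE_lborel_singleton[of "\<theta> * t"]
      by eventually_elim (rule *)
  qed
  also have "2 * \<dots> = (\<integral>\<^sup>+l. ennreal (2 * heat (t - l / \<theta>) (l + ?x) + 1 / \<phi> * hit_density (t - l / \<theta>) (l + ?x))
      * indicator {0<..<\<theta> * t} l \<partial>lborel)"
    unfolding normal_density_def
    by (subst nn_integral_cmult[symmetric]) 
       (auto intro!: nn_integral_cong simp: distrib_left ennreal_mult'' ennreal_numeral[symmetric]
          simp del: ennreal_numeral simp flip: mult.assoc ennreal_mult')
  finally show ?thesis .
qed

lemma nn_integral_sbm_nn_density_eq_1:
  fixes i :: "'d::finite"
  assumes "0 < a" "0 < \<theta>" "0 < t" "x \<in> half_space i"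
  shows "(\<integral>\<^sup>+y. sbm_nn_density i a \<theta> t x y \<partial>sticky_measure i \<theta>) = 1"
proof -
  have "0 \<le> x $ i" using assms by (simp add: half_space_def)
  \<comment> \<open>The masses of the two terms add up inside \<open>ennreal\<close> only if both
    are nonnegative; for the first this says that the distribution function is at least 1/2.\<close>
  then have "1 / 2 \<le> std_normal_cdf (x $ i / sqrt t)"
    using std_normal_cdf_minus[of 0] std_normal_cdf_mono[of 0 "x $ i / sqrt t"] assms by simp
  then show ?thesis
    using assms \<open>0 \<le> x $ i\<close> std_normal_cdf_bounds[of "x $ i / sqrt t"]
    by (subst nn_integral_sbm_nn_density)
       (simp_all add: nn_integral_boundary_flux del: times_divide_eq_left divide_eq_eq_numeral flip: ennreal_plus)
qed

text \<open>The atom has weight \<open>1 / (2 * \<phi>)\<close>, so a larger stickiness of the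
  reference measure only loses mass.\<close>

lemma nn_integral_sbm_nn_density_le_1:
  fixes i :: "'d::finite"
  assumes "0 < a" "0 < \<theta>" "0 < t" "\<theta> \<le> \<phi>" "x \<in> half_space i"
  shows "(\<integral>\<^sup>+y. sbm_nn_density i a \<theta> t x y \<partial>sticky_measure i \<phi>) \<le> 1"
proof -
  have "(\<integral>\<^sup>+y. sbm_nn_density i a \<theta> t x y \<partial>sticky_measure i \<phi>) \<le>
     (\<integral>\<^sup>+y. sbm_nn_density i a \<theta> t x y \<partial>sticky_measure i \<theta>)"
    using assms
    by (auto simp: nn_integral_sbm_nn_density intro!: add_left_mono nn_integral_mono mult_right_mono
        ennreal_leI divide_left_mono hit_density_nonneg)
  then show ?thesis using assms by (simp add: nn_integral_sbm_nn_density_eq_1)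
qed

text \<open>Total mass one makes \<open>sbm_nn_density\<close> finite almost everywhere, and where
  it is finite the Lebesgue integral in \<open>sbm_density\<close> has the same value as the
  nonnegative one.\<close>

lemma sbm_kernel_eq:
  fixes i :: "'d::finite"
  assumes "0 < a" "0 < \<theta>" "0 < t" "x \<in> half_space i"
  shows "sbm_kernel i a \<theta> t x = density (sticky_measure i \<theta>) (sbm_nn_density i a \<theta> t x)"
  unfolding sbm_kernel_def
proof (rule density_cong)
  show "(\<lambda>y. ennreal (sbm_density i a \<theta> t x y)) \<in> borel_measurable (sticky_measure i \<theta>)"
  proof (rule measurable_sticky_measure)
    have "(\<lambda>(y, l). indicator {0..\<theta> * t} l *\<^sub>R (hit_density (t - l / \<theta>) (l + x $ i + y $ i) *
        gauss_tang (t + (a - 1) * (l / \<theta>)) (tang i y - tang i x)))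
      \<in> borel_measurable (borel \<Otimes>\<^sub>M borel)" by measurable
    then have "(\<lambda>y. LBINT l:{0..\<theta> * t}. hit_density (t - l / \<theta>) (l + x $ i + y $ i) *
        gauss_tang (t + (a - 1) * (l / \<theta>)) (tang i y - tang i x)) \<in> borel_measurable borel"
      unfolding set_lebesgue_integral_def by (intro lborel.borel_measurable_lebesgue_integral) simp
    then show "(\<lambda>y. ennreal (sbm_density i a \<theta> t x y)) \<in> borel_measurable borel"
      unfolding sbm_density_def by measurable
  qed
  show "sbm_nn_density i a \<theta> t x \<in> borel_measurable (sticky_measure i \<theta>)"
    by (intro measurable_sticky_measure) measurable
  have "AE y in sticky_measure i \<theta>. sbm_nn_density i a \<theta> t x y \<noteq> \<infinity>"
    using assms by (intro nn_integral_PInf_AE)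
      (auto simp: nn_integral_sbm_nn_density_eq_1 intro!: measurable_sticky_measure)
  moreover have "AE y in sticky_measure i \<theta>. y \<in> half_space i"
    by (rule AE_I2) (simp add: sticky_measure_def space_restrict_space)
  ultimately show "AE y in sticky_measure i \<theta>. ennreal (sbm_density i a \<theta> t x y) = sbm_nn_density i a \<theta> t x y"
  proof eventually_elim
    case (elim y)
    let ?k = "\<lambda>l. hit_density (t - l / \<theta>) (l + x $ i + y $ i) *
            gauss_tang (t + (a - 1) * (l / \<theta>)) (tang i y - tang i x)"
    let ?N = "\<integral>\<^sup>+l. ennreal (?k l) * indicator {0..\<theta> * t} l \<partial>lborel"
    have k: "0 \<le> ?k l" for l by (simp add: hit_density_nonneg gauss_tang_nonneg)
    have "?N \<noteq> \<infinity>" using elim(1) by (auto simp: sbm_nn_density_def ennreal_mult_eq_top_iff)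
    moreover have "(LBINT l:{0..\<theta> * t}. ?k l) = enn2real ?N"
      unfolding set_lebesgue_integral_def using k
      by (subst integral_eq_nn_integral)
         (auto intro!: arg_cong[where f = enn2real] nn_integral_cong split: split_indicator)
    moreover have "0 \<le> g0 t (x $ i) (y $ i) * gauss_tang t (tang i y - tang i x)"
      using assms elim(2) by (intro mult_nonneg_nonneg g0_nonneg gauss_tang_nonneg) (auto simp: half_space_def)
    ultimately show ?case
      by (simp add: sbm_density_def sbm_nn_density_def ennreal_mult' less_top)
  qed
qed

subsection \<open>The cost function\<close>

text \<open>The cost depends only on the normal coordinates \<open>X\<close>, \<open>Y\<close> and
  the tangential distance \<open>Z\<close>. The cone condition is written as
  \<open>h \<le> 0\<close>, the form in which \<open>continuous_on_cases_le\<close> glues two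
  continuous branches.\<close>

definition split_cost :: "real \<Rightarrow> real \<Rightarrow> real \<Rightarrow> real \<Rightarrow> real" where
  "split_cost a X Y Z =
     (if a \<le> 1 \<or> Z - 1 / sqrt (a - 1) * (X + Y + 2 * sqrt a * sqrt (X * Y)) \<le> 0
      then ((X - Y)\<^sup>2 + Z\<^sup>2) / 2
      else (sqrt (a - 1) * (X + Y) + Z)\<^sup>2 / (2 * a))"

lemma norm_diff_eq_split:
  "(norm (x - y))\<^sup>2 = (x $ i - y $ i)\<^sup>2 + (norm (tang i y - tang i x))\<^sup>2"
proof -
  have "(norm (x - y))\<^sup>2 = (\<Sum>j\<in>UNIV. (x $ j - y $ j)\<^sup>2)"
    by (simp add: norm_vec_def L2_set_def sum_nonneg)
  also have "\<dots> = (x $ i - y $ i)\<^sup>2 + (\<Sum>j\<in>UNIV - {i}. (x $ j - y $ j)\<^sup>2)"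
    by (rule sum.remove) auto
  finally show ?thesis by (simp add: norm_tang_diff power2_commute)
qed

lemma sbm_cost_eq_split_cost:
  assumes "x \<in> half_space i" "y \<in> half_space i"
  shows "sbm_cost i a x y = split_cost a (x $ i) (y $ i) (norm (tang i y - tang i x))"
  using assms
  by (simp add: sbm_cost_def split_cost_def cost_cone_def half_space_def norm_diff_eq_split[of x y i])

text \<open>
  Applied with \<open>w = sqrt (a - 1)\<close>, so that \<open>a = w\<^sup>2 + 1\<close>: it turns the cone condition, which compares
  \<open>w Z - R\<close> with \<open>2 sqrt (a X Y)\<close>, into a comparison of the two costs.
\<close>

lemma cone_identity:
  fixes w R Z :: real
  shows "(w * R + Z)\<^sup>2 = (w\<^sup>2 + 1) * (R\<^sup>2 + Z\<^sup>2) - (w * Z - R)\<^sup>2"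
  by (simp add: power2_eq_square algebra_simps)

text \<open>Outside the cone \<open>w * Z - (X + Y)\<close> exceeds
  \<open>2 * sqrt a * sqrt (X * Y)\<close>. Squaring this and inserting it in
  \<open>cone_identity\<close> turns \<open>(X + Y)\<^sup>2\<close> into
  \<open>(X - Y)\<^sup>2\<close>.\<close>

lemma split_cost_le_direct:
  assumes "0 < a" "0 \<le> X" "0 \<le> Y" "0 \<le> Z"
  shows "split_cost a X Y Z \<le> ((X - Y)\<^sup>2 + Z\<^sup>2) / 2"
proof (cases "a \<le> 1 \<or> Z - 1 / sqrt (a - 1) * (X + Y + 2 * sqrt a * sqrt (X * Y)) \<le> 0")
  case False
  define w where "w = sqrt (a - 1)"
  have w: "0 < w" "a = w\<^sup>2 + 1" using False by (auto simp: w_def)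
  have "2 * sqrt a * sqrt (X * Y) \<le> w * Z - (X + Y)"
    using False w(1) by (simp add: field_simps flip: w_def)
  then have "(2 * sqrt a * sqrt (X * Y))\<^sup>2 \<le> (w * Z - (X + Y))\<^sup>2"
    using assms by (intro power_mono) auto
  then have "4 * a * (X * Y) \<le> (w * Z - (X + Y))\<^sup>2"
    using assms by (simp add: power_mult_distrib)
  then have "(w * (X + Y) + Z)\<^sup>2 \<le> a * ((X - Y)\<^sup>2 + Z\<^sup>2)"
    unfolding cone_identity w(2) by (simp add: power2_eq_square algebra_simps)
  then show ?thesis
    using False assms by (simp add: split_cost_def w_def field_simps)
qed (simp add: split_cost_def)

text \<open>The defect is an explicit square, so equality holds exactly when
  \<open>q * R = w * p * Z\<close>.\<close>

lemma weighted_cauchy_schwarz: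
  fixes w R Z p q :: real
  assumes "0 < p" "0 < q"
  shows "(w * R + Z)\<^sup>2 \<le> (w\<^sup>2 * p + q) * (R\<^sup>2 / p + Z\<^sup>2 / q)"
proof -
  have "(w\<^sup>2 * p + q) * (R\<^sup>2 / p + Z\<^sup>2 / q) - (w * R + Z)\<^sup>2 = (q * R - w * p * Z)\<^sup>2 / (p * q)"
    using assms by (simp add: field_simps power2_eq_square)
  also have "\<dots> \<ge> 0" using assms by simp
  finally show ?thesis by simp
qed

text \<open>The bracket is convex in \<open>\<tau>\<close> with slope
  \<open>R\<^sup>2 - (a - 1) * Z\<^sup>2\<close> at 0, where \<open>R = X + Y\<close>. If the slope
  is nonnegative, the value at 0 is a lower bound and already dominates the direct cost. Otherwise
  \<open>a > 1\<close>, and the cost is at most \<open>(w * R + Z)\<^sup>2 / (2 * a)\<close>, the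
  lower bound from Cauchy-Schwarz.\<close>

lemma split_cost_le_boundary:
  assumes "0 < a" "0 \<le> X" "0 \<le> Y" "0 \<le> Z" "0 \<le> \<tau>" "\<tau> < 1"
  shows "2 * split_cost a X Y Z \<le> (X + Y)\<^sup>2 / (1 - \<tau>) + Z\<^sup>2 / (1 + (a - 1) * \<tau>)"
proof -
  let ?R = "X + Y" and ?q = "1 + (a - 1) * \<tau>"
  let ?P = "?R\<^sup>2 / (1 - \<tau>) + Z\<^sup>2 / ?q"
  have q: "0 < ?q" using assms by (intro tangential_time_pos) auto
  have direct: "2 * split_cost a X Y Z \<le> ?R\<^sup>2 + Z\<^sup>2"
  proof -
    have "(X - Y)\<^sup>2 \<le> ?R\<^sup>2" using assms by (simp add: power2_eq_square algebra_simps)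
    then show ?thesis using split_cost_le_direct[OF assms(1-4)] by (simp add: field_simps)
  qed
  show ?thesis
  proof (cases "(a - 1) * Z\<^sup>2 \<le> ?R\<^sup>2")
    case True
    have "?R\<^sup>2 * ?q - (a - 1) * Z\<^sup>2 * (1 - \<tau>) \<ge> 0"
    proof -
      have "(a - 1) * Z\<^sup>2 * (1 - \<tau>) \<le> ?R\<^sup>2 * ?q"
      proof (cases "a \<le> 1")
        case True
        then have "(a - 1) * Z\<^sup>2 * (1 - \<tau>) \<le> 0"
          using assms by (intro mult_nonpos_nonneg) auto
        also have "0 \<le> ?R\<^sup>2 * ?q" using q by simp
        finally show ?thesis .
      next
        case False
        have "(a - 1) * Z\<^sup>2 * (1 - \<tau>) \<le> ?R\<^sup>2 * (1 - \<tau>)"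
          using True assms by (intro mult_right_mono) auto
        also have "\<dots> \<le> ?R\<^sup>2 * ?q"
        proof (rule mult_left_mono)
          have "0 \<le> (a - 1) * \<tau>" using False assms by simp
          then show "1 - \<tau> \<le> ?q" using assms by linarith
        qed simp
        finally show ?thesis .
      qed
      then show ?thesis by simp
    qed
    then have "0 \<le> \<tau> * (?R\<^sup>2 * ?q - (a - 1) * Z\<^sup>2 * (1 - \<tau>)) / ((1 - \<tau>) * ?q)"
      using assms q by simp
    also have "\<dots> = ?P - (?R\<^sup>2 + Z\<^sup>2)"
    proof -
      have "?R\<^sup>2 / (1 - \<tau>) - ?R\<^sup>2 = \<tau> * ?R\<^sup>2 / (1 - \<tau>)" "Z\<^sup>2 / ?q - Z\<^sup>2 = - (\<tau> * (a - 1) * Z\<^sup>2 / ?q)"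
        using assms q by (simp_all add: field_simps)
      then have "?P - (?R\<^sup>2 + Z\<^sup>2) = \<tau> * ?R\<^sup>2 / (1 - \<tau>) - \<tau> * (a - 1) * Z\<^sup>2 / ?q" by simp
      also have "\<dots> = (\<tau> * ?R\<^sup>2 * ?q - \<tau> * (a - 1) * Z\<^sup>2 * (1 - \<tau>)) / ((1 - \<tau>) * ?q)"
        using assms q by (intro diff_frac_eq) auto
      finally show ?thesis
        using right_diff_distrib[of \<tau> "?R\<^sup>2 * ?q" "(a - 1) * Z\<^sup>2 * (1 - \<tau>)"] by (simp only: mult.assoc)
    qed
    finally show ?thesis using direct by simp
  next
    case False
    have a: "1 < a"
    proof (rule ccontr)
      assume "\<not> 1 < a"
      then have "(a - 1) * Z\<^sup>2 \<le> 0" by (simp add: mult_nonpos_nonneg)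
      then show False using False zero_le_power2[of ?R] by linarith
    qed
    define w where "w = sqrt (a - 1)"
    have w: "0 < w" "a = w\<^sup>2 + 1" using a by (auto simp: w_def)
    have "2 * split_cost a X Y Z \<le> (w * ?R + Z)\<^sup>2 / a"
    proof (cases "Z - 1 / w * (?R + 2 * sqrt a * sqrt (X * Y)) \<le> 0")
      case True
      \<comment> \<open>Inside the cone the direct cost must be compared with the boundary formula.
        The negative slope gives \<open>R < w * Z\<close>, so the cone condition may be squared and
        \<open>cone_identity\<close> yields the inequality.\<close>
      have "?R\<^sup>2 < (w * Z)\<^sup>2" using False w(2) by (simp add: power_mult_distrib)
      moreover have "0 \<le> w * Z" using w(1) assms(4) by simp
      ultimately have "?R < w * Z" by (rule power2_less_imp_less)
      moreover have "w * Z - ?R \<le> 2 * sqrt a * sqrt (X * Y)"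
        using True w(1) by (simp add: field_simps)
      ultimately have "(w * Z - ?R)\<^sup>2 \<le> (2 * sqrt a * sqrt (X * Y))\<^sup>2"
        by (intro power_mono) auto
      then have "(w * Z - ?R)\<^sup>2 \<le> 4 * a * (X * Y)"
        using assms by (simp add: power_mult_distrib)
      then have "a * ((X - Y)\<^sup>2 + Z\<^sup>2) \<le> (w * ?R + Z)\<^sup>2"
        unfolding cone_identity w(2) by (simp add: power2_eq_square algebra_simps)
      then show ?thesis
        using True a by (simp add: split_cost_def w_def field_simps)
    qed (use a in \<open>simp add: split_cost_def w_def\<close>)
    also have "\<dots> \<le> ?P"
    proof -
      \<comment> \<open>The weights \<open>p = 1 - \<tau>\<close> and
        \<open>q = 1 + (a - 1) * \<tau>\<close> are such that \<open>w\<^sup>2 * p + q\<close> does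
        not depend on \<open>\<tau>\<close>.\<close>
      have "w\<^sup>2 * (1 - \<tau>) + ?q = a" by (simp add: w(2) algebra_simps)
      then have "(w * ?R + Z)\<^sup>2 \<le> a * ?P"
        using weighted_cauchy_schwarz[of "1 - \<tau>" ?q w ?R Z] q assms by simp
      then show ?thesis using a by (simp add: field_simps)
    qed
    finally show ?thesis .
  qed
qed

text \<open>This selects the term of the density that carries the lower bound. The direct term is
  usable only for \<open>X > 0\<close>, since \<open>g0\<close> vanishes at \<open>X = 0\<close>;
  there the boundary bracket tends to the same value as \<open>\<tau>\<close> tends to 0. Outside
  the cone the equality case of Cauchy-Schwarz gives the minimising \<open>\<tau>\<close>.\<close>

lemma split_cost_attained:
  assumes "0 < a" "0 \<le> X" "0 < Y" "0 \<le> Z" "0 < \<eta>"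
  obtains (direct) "0 < X" "2 * split_cost a X Y Z = (X - Y)\<^sup>2 + Z\<^sup>2"
  | (boundary) \<tau> where "0 < \<tau>" "\<tau> < 1"
      "(X + Y)\<^sup>2 / (1 - \<tau>) + Z\<^sup>2 / (1 + (a - 1) * \<tau>) < 2 * split_cost a X Y Z + \<eta>"
proof (cases "a \<le> 1 \<or> Z - 1 / sqrt (a - 1) * (X + Y + 2 * sqrt a * sqrt (X * Y)) \<le> 0")
  case True
  then have c: "2 * split_cost a X Y Z = (X - Y)\<^sup>2 + Z\<^sup>2" by (simp add: split_cost_def)
  show ?thesis
  proof (cases "X = 0")
    case True
    let ?P = "\<lambda>\<tau>. (X + Y)\<^sup>2 / (1 - \<tau>) + Z\<^sup>2 / (1 + (a - 1) * \<tau>)"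
    have "(?P \<longlongrightarrow> (X + Y)\<^sup>2 / (1 - 0) + Z\<^sup>2 / (1 + (a - 1) * 0)) (at_right 0)"
      by (intro tendsto_intros) auto
    moreover have "(X + Y)\<^sup>2 / (1 - 0) + Z\<^sup>2 / (1 + (a - 1) * 0) < 2 * split_cost a X Y Z + \<eta>"
      using True c assms by simp
    ultimately have "\<forall>\<^sub>F \<tau> in at_right 0. ?P \<tau> < 2 * split_cost a X Y Z + \<eta>"
      by (rule order_tendstoD)
    moreover have "\<forall>\<^sub>F \<tau> in at_right (0::real). 0 < \<tau> \<and> \<tau> < 1"
      by (auto simp: eventually_at_right_field intro: exI[of _ 1])
    ultimately have "\<forall>\<^sub>F \<tau> in at_right 0. ?P \<tau> < 2 * split_cost a X Y Z + \<eta> \<and> 0 < \<tau> \<and> \<tau> < 1"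
      by (rule eventually_conj)
    then obtain \<tau> where "?P \<tau> < 2 * split_cost a X Y Z + \<eta>" "0 < \<tau>" "\<tau> < 1"
      using eventually_happens[of _ "at_right (0::real)"] by auto
    then show ?thesis by (intro boundary)
  qed (use assms c in \<open>auto intro: direct\<close>)
next
  case False
  let ?R = "X + Y"
  define w where "w = sqrt (a - 1)"
  have w: "0 < w" "a = w\<^sup>2 + 1" using False by (auto simp: w_def)
  have R: "0 < ?R" using assms by simp
  have "?R + 2 * sqrt a * sqrt (X * Y) < w * Z"
    using False w(1) by (simp add: field_simps flip: w_def)
  moreover have "0 \<le> 2 * sqrt a * sqrt (X * Y)" using assms by simp
  ultimately have wZ: "?R < w * Z" by linarith
  define D where "D = w * Z + w\<^sup>2 * ?R"
  \<comment> \<open>the equality case of \<open>weighted_cauchy_schwarz\<close>: \<open>\<tau>\<close> solves \<open>(1 + (a - 1) \<tau>) R = w (1 - \<tau>) Z\<close>\<close>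
  define \<tau> where "\<tau> = (w * Z - ?R) / D"
  have D: "0 < D" using R wZ w(1) by (auto simp: D_def intro!: add_pos_nonneg)
  have \<tau>: "0 < \<tau>" using wZ D by (simp add: \<tau>_def)
  have p: "1 - \<tau> = a * ?R / D" using D by (simp add: \<tau>_def D_def w(2) field_simps)
  have q: "1 + (a - 1) * \<tau> = a * (w * Z) / D"
    using D by (simp add: \<tau>_def D_def w(2) field_simps power2_eq_square)
  have "0 < 1 - \<tau>" unfolding p using assms D R by simp
  have r: "r\<^sup>2 / (a * r / D) = D / a * r" if "0 < r" for r
    using that assms D by (simp add: field_simps power2_eq_square)
  have "0 < Z" using wZ R w(1) by (metis less_trans zero_less_mult_pos)
  have "Z\<^sup>2 / (a * (w * Z) / D) = (w * Z)\<^sup>2 / (a * (w * Z) / D) / w\<^sup>2"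
    using w(1) by (simp add: power_mult_distrib)
  also have "\<dots> = D / a * (w * Z) / w\<^sup>2"
    using r[of "w * Z"] \<open>0 < Z\<close> w(1) by simp
  also have "\<dots> = D / a * (Z / w)"
    using w(1) by (simp add: power2_eq_square)
  finally have "?R\<^sup>2 / (1 - \<tau>) + Z\<^sup>2 / (1 + (a - 1) * \<tau>) = D / a * (?R + Z / w)"
    unfolding p q r[OF R] by (simp add: distrib_left)
  also have "\<dots> = (w * ?R + Z)\<^sup>2 / a"
    unfolding D_def using w(1) assms by (simp add: field_simps power2_eq_square)
  also have "\<dots> = 2 * split_cost a X Y Z"
    using False by (simp add: split_cost_def w_def)
  finally show ?thesis
    using \<tau> \<open>0 < 1 - \<tau>\<close> assms by (intro boundary[of \<tau>]) auto
qed

text \<open>This bounds the sublevel sets of the cost. Outside the cone,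
  \<open>w * \<bar>X - Y\<bar>\<close> and \<open>Z\<close> are both controlled by
  \<open>w * (X + Y) + Z\<close>; the constants of the two branches are added instead of taking
  their maximum.\<close>

lemma split_cost_coercive:
  assumes "0 < a" "0 \<le> X" "0 \<le> Y" "0 \<le> Z"
  shows "(X - Y)\<^sup>2 + Z\<^sup>2 \<le> (2 + (if a \<le> 1 then 0 else 2 * a + 2 * a / (a - 1))) * split_cost a X Y Z"
proof (cases "a \<le> 1 \<or> Z - 1 / sqrt (a - 1) * (X + Y + 2 * sqrt a * sqrt (X * Y)) \<le> 0")
  case True
  then have c: "(X - Y)\<^sup>2 + Z\<^sup>2 = 2 * split_cost a X Y Z" by (simp add: split_cost_def)
  then have "0 \<le> split_cost a X Y Z" by (metis sum_power2_ge_zero zero_le_mult_iff zero_le_numeral not_numeral_le_zero linorder_linear)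
  then show ?thesis unfolding c using assms by (intro mult_right_mono) auto
next
  case False
  let ?R = "X + Y"
  define w where "w = sqrt (a - 1)"
  have w: "0 < w" "a = w\<^sup>2 + 1" using False by (auto simp: w_def)
  have "w\<^sup>2 * (X - Y)\<^sup>2 + Z\<^sup>2 \<le> (w * ?R)\<^sup>2 + Z\<^sup>2"
    using assms w(1) by (auto simp: power_mult_distrib power2_eq_square algebra_simps)
  also have "\<dots> \<le> (w * ?R + Z)\<^sup>2"
    using assms w(1) by (simp add: power2_sum)
  also have "\<dots> = 2 * a * split_cost a X Y Z" (is "_ = ?c")
    using False assms by (simp add: split_cost_def w_def)
  finally have *: "w\<^sup>2 * (X - Y)\<^sup>2 + Z\<^sup>2 \<le> ?c" .
  have "w\<^sup>2 * (X - Y)\<^sup>2 \<le> ?c" using * zero_le_power2[of Z] by linarith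
  then have "(X - Y)\<^sup>2 \<le> ?c / w\<^sup>2" using w(1) by (simp add: field_simps)
  moreover have "0 \<le> w\<^sup>2 * (X - Y)\<^sup>2" by simp
  then have "Z\<^sup>2 \<le> ?c" using * by linarith
  ultimately have "(X - Y)\<^sup>2 + Z\<^sup>2 \<le> ?c + ?c / w\<^sup>2" by linarith
  also have "\<dots> = (2 * a + 2 * a / (a - 1)) * split_cost a X Y Z"
    using w(2) by (simp add: distrib_right)
  also have "\<dots> \<le> (2 + (2 * a + 2 * a / (a - 1))) * split_cost a X Y Z"
    using False assms by (intro mult_right_mono) (auto simp: split_cost_def)
  finally show ?thesis using False by simp
qed

lemma split_cost_nonneg: "0 < a \<Longrightarrow> 0 \<le> split_cost a X Y Z"
  by (simp add: split_cost_def)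

section \<open>Symmetry, continuity and compact sublevel sets of the cost\<close>

lemma sbm_cost_commute: "sbm_cost i a x y = sbm_cost i a y x"
  by (simp add: sbm_cost_def cost_cone_def norm_minus_commute add.commute mult.commute conj_commute
      conj_left_commute)

text \<open>On the boundary of the cone \<open>w * Z - (X + Y)\<close> equals
  \<open>2 * sqrt a * sqrt (X * Y)\<close>, and \<open>cone_identity\<close> then makes the two
  continuous branches agree.\<close>

lemma continuous_on_sbm_cost:
  assumes "0 < a"
  shows "continuous_on (half_space i \<times> half_space i) (\<lambda>(x, y). sbm_cost i a x y)"
proof (cases "a \<le> 1")
  case True
  then show ?thesis
    by (auto simp: sbm_cost_def case_prod_beta intro!: continuous_intros)
next
  case False
  define w where "w = sqrt (a - 1)"
  have w: "0 < w" "a = w\<^sup>2 + 1" using False by (auto simp: w_def)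
  let ?X = "\<lambda>p. fst p $ i" and ?Y = "\<lambda>p. snd p $ i"
  let ?Z = "\<lambda>p. norm (tang i (snd p) - tang i (fst p))"
  let ?h = "\<lambda>p. ?Z p - 1 / w * (?X p + ?Y p + 2 * sqrt a * sqrt (?X p * ?Y p))"
  let ?f = "\<lambda>p. if ?h p \<le> 0 then ((?X p - ?Y p)\<^sup>2 + (?Z p)\<^sup>2) / 2
    else (w * (?X p + ?Y p) + ?Z p)\<^sup>2 / (2 * a)"
  have "continuous_on (half_space i \<times> half_space i) ?f"
  proof (rule continuous_on_cases_le)
    fix p assume p: "p \<in> half_space i \<times> half_space i" "?h p = 0"
    then have nn: "0 \<le> ?X p" "0 \<le> ?Y p" by (auto simp: half_space_def)
    have "w * ?Z p - (?X p + ?Y p) = 2 * sqrt a * sqrt (?X p * ?Y p)"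
      using p(2) w(1) by (simp add: field_simps)
    then have "(w * ?Z p - (?X p + ?Y p))\<^sup>2 = (2 * sqrt a * sqrt (?X p * ?Y p))\<^sup>2" by simp
    also have "\<dots> = 4 * a * (?X p * ?Y p)"
      using nn assms by (simp add: power_mult_distrib)
    finally have "(w * (?X p + ?Y p) + ?Z p)\<^sup>2 = a * ((?X p - ?Y p)\<^sup>2 + (?Z p)\<^sup>2)"
      unfolding cone_identity w(2) by (simp add: power2_eq_square algebra_simps)
    then show "((?X p - ?Y p)\<^sup>2 + (?Z p)\<^sup>2) / 2 = (w * (?X p + ?Y p) + ?Z p)\<^sup>2 / (2 * a)"
      using assms by (simp add: field_simps)
  qed (use assms w(1) in \<open>auto intro!: continuous_intros continuous_on_component\<close>)
  also have "continuous_on (half_space i \<times> half_space i) ?f \<longleftrightarrow>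
      continuous_on (half_space i \<times> half_space i) (\<lambda>(x, y). sbm_cost i a x y)"
    using False by (intro continuous_on_cong)
      (auto simp: sbm_cost_eq_split_cost split_cost_def w_def)
  finally show ?thesis .
qed

lemma closed_half_space: "closed (half_space i)"
  unfolding half_space_def by (intro closed_Collect_le continuous_intros continuous_on_component)

lemma continuous_on_sbm_cost_right:
  assumes "0 < a" "x \<in> half_space i"
  shows "continuous_on (half_space i) (sbm_cost i a x)"
  using continuous_on_compose2[OF continuous_on_sbm_cost[OF assms(1), of i]
      continuous_on_Pair[OF continuous_on_const[of "half_space i" x] continuous_on_id]] assms(2)
  by (auto simp: image_subset_iff)

lemma good_rate_function_sbm_cost:
  assumes "0 < a" "x \<in> half_space i"
  shows "good_rate_function (half_space i) (\<lambda>y. ereal (sbm_cost i a x y))"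
  unfolding good_rate_function_def
proof (intro conjI allI ballI)
  fix y assume "y \<in> half_space i"
  then show "0 \<le> ereal (sbm_cost i a x y)"
    using assms by (simp add: sbm_cost_eq_split_cost split_cost_nonneg)
next
  note cont = continuous_on_sbm_cost_right[OF assms]
  fix \<alpha> :: ereal
  have "continuous_on (half_space i) (\<lambda>y. ereal (sbm_cost i a x y))"
    using cont by (intro continuous_intros)
  then have "openin (top_of_set (half_space i)) (half_space i \<inter> (\<lambda>y. ereal (sbm_cost i a x y)) -` {\<alpha><..})"
    by (intro continuous_openin_preimage_gen) auto
  moreover have "half_space i \<inter> (\<lambda>y. ereal (sbm_cost i a x y)) -` {\<alpha><..} =
      {y \<in> half_space i. \<alpha> < ereal (sbm_cost i a x y)}" by auto
  ultimately show "openin (top_of_set (half_space i)) {y \<in> half_space i. \<alpha> < ereal (sbm_cost i a x y)}"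
    by simp
next
  note cont = continuous_on_sbm_cost_right[OF assms]
  fix \<alpha> :: real
  let ?S = "{y \<in> half_space i. ereal (sbm_cost i a x y) \<le> ereal \<alpha>}"
  have S: "?S = half_space i \<inter> sbm_cost i a x -` {..\<alpha>}" by auto
  have "closed ?S"
    unfolding S using cont closed_half_space by (intro continuous_closed_preimage) auto
  moreover have "bounded ?S"
  proof -
    define K where "K = 2 + (if a \<le> 1 then 0 else 2 * a + 2 * a / (a - 1))"
    have "0 \<le> K" using assms by (simp add: K_def)
    have "norm (x - y) \<le> sqrt (K * \<bar>\<alpha>\<bar>)" if "y \<in> ?S" for y
    proof -
      have "(norm (x - y))\<^sup>2 \<le> K * sbm_cost i a x y"
        using assms that split_cost_coercive[of a "x $ i" "y $ i" "norm (tang i y - tang i x)"]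
        by (simp add: norm_diff_eq_split[of x y i] sbm_cost_eq_split_cost half_space_def flip: K_def)
      also have "\<dots> \<le> K * \<bar>\<alpha>\<bar>" using that \<open>0 \<le> K\<close> by (intro mult_left_mono) auto
      finally show ?thesis by (rule real_le_rsqrt)
    qed
    then have "?S \<subseteq> cball x (sqrt (K * \<bar>\<alpha>\<bar>))" by (auto simp: dist_norm)
    then show ?thesis using bounded_cball bounded_subset by blast
  qed
  ultimately show "compact ?S" by (simp add: compact_eq_bounded_closed)
qed

subsection \<open>Upper bound\<close>

text \<open>\<open>1 - exp (- u)\<close> is concave in \<open>u\<close> and vanishes at 0. It
  controls the non-Gaussian factor of \<open>g0\<close> under the change of time from
  \<open>t\<close> to \<open>t / k\<close>.\<close>

lemma one_minus_exp_le:
  fixes k u :: real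
  assumes "0 < k" "k \<le> 1"
  shows "1 - exp (- u) \<le> (1 - exp (- (k * u))) / k"
proof -
  have "exp ((1 - k) *\<^sub>R 0 + k *\<^sub>R (- u)) \<le> (1 - k) * exp 0 + k * exp (- u)"
    using assms by (intro convex_onD[OF exp_convex]) auto
  then show ?thesis using assms by (simp add: field_simps)
qed

text \<open>Separates the exponential rate of the direct path from a factor between 0 and 1, for
  positive \<open>t\<close> and nonnegative \<open>X\<close>, \<open>Y\<close>, that accounts for
  killing at the boundary.\<close>

lemma g0_factor:
  "g0 t X Y = 1 / sqrt (2 * pi * t) * exp (- ((X - Y)\<^sup>2 / (2 * t))) * (1 - exp (- (2 * X * Y / t)))"
proof -
  have "(X + Y)\<^sup>2 / (2 * t) = (X - Y)\<^sup>2 / (2 * t) + 2 * X * Y / t"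
    by (cases "t = 0") (simp_all add: field_simps power2_eq_square)
  then have "exp (- ((X + Y)\<^sup>2 / (2 * t))) = exp (- ((X - Y)\<^sup>2 / (2 * t))) * exp (- (2 * X * Y / t))"
    by (simp flip: exp_add)
  then show ?thesis by (simp add: g0_def right_diff_distrib diff_divide_distrib)
qed

text \<open>Tilting a kernel at time \<open>t\<close> by the fraction \<open>1 - k\<close> of its Gaussian exponent turns it, up
  to a power of \<open>k\<close>, into the same kernel at time \<open>t / k\<close>.\<close>

lemma gauss_tang_tilt:
  fixes z :: "real ^ 'd::finite"
  assumes "0 < t" "0 < k"
  shows "exp ((1 - k) * (norm z)\<^sup>2 / (2 * t)) * gauss_tang t z =
    k powr (- ((real CARD('d) - 1) / 2)) * gauss_tang (t / k) z"
proof -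
  have "(1 - k) * (norm z)\<^sup>2 / (2 * t) + - ((norm z)\<^sup>2 / (2 * t)) = - ((norm z)\<^sup>2 / (2 * (t / k)))"
    using assms by (simp add: field_simps)
  then have "exp ((1 - k) * (norm z)\<^sup>2 / (2 * t)) * exp (- ((norm z)\<^sup>2 / (2 * t)))
      = exp (- ((norm z)\<^sup>2 / (2 * (t / k))))"
    by (simp flip: exp_add)
  moreover have "(2 * pi * (t / k)) powr e = (2 * pi * t) powr e / k powr e" for e
    using assms powr_divide[of "2 * pi * t" k e] by simp
  ultimately show ?thesis
    using assms by (simp add: gauss_tang_def powr_minus_divide field_simps)
qed

lemma hit_density_tilt:
  assumes "0 < t" "0 < k"
  shows "exp ((1 - k) * r\<^sup>2 / (2 * t)) * hit_density t r = k powr (- (3 / 2)) * hit_density (t / k) r"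
proof -
  have "(1 - k) * r\<^sup>2 / (2 * t) + - (r\<^sup>2 / (2 * t)) = - (r\<^sup>2 / (2 * (t / k)))"
    using assms by (simp add: field_simps)
  then have "exp ((1 - k) * r\<^sup>2 / (2 * t)) * exp (- (r\<^sup>2 / (2 * t))) = exp (- (r\<^sup>2 / (2 * (t / k))))"
    by (simp flip: exp_add)
  moreover have "(t / k) powr (3 / 2) = t powr (3 / 2) / k powr (3 / 2)"
    using assms by (simp add: powr_divide)
  ultimately show ?thesis
    using assms by (simp add: hit_density_def powr_minus_divide field_simps)
qed

text \<open>The last factor in \<open>g0_factor\<close> is not Gaussian, so only an inequality
  holds. The power 3/2, the same as for \<open>hit_density\<close>, consists of 1/2 from the
  normalisation and 1 from \<open>one_minus_exp_le\<close>.\<close>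

lemma g0_tilt:
  assumes "0 < t" "0 < k" "k \<le> 1" "0 \<le> X" "0 \<le> Y"
  shows "exp ((1 - k) * (X - Y)\<^sup>2 / (2 * t)) * g0 t X Y \<le> k powr (- (3 / 2)) * g0 (t / k) X Y"
proof -
  let ?e = "exp (- ((X - Y)\<^sup>2 / (2 * (t / k))))"
  have "(1 - k) * (X - Y)\<^sup>2 / (2 * t) + - ((X - Y)\<^sup>2 / (2 * t)) = - ((X - Y)\<^sup>2 / (2 * (t / k)))"
    using assms by (simp add: field_simps)
  then have e: "exp ((1 - k) * (X - Y)\<^sup>2 / (2 * t)) * exp (- ((X - Y)\<^sup>2 / (2 * t))) = ?e"
    by (simp flip: exp_add)
  have "exp ((1 - k) * (X - Y)\<^sup>2 / (2 * t)) * g0 t X Y = 1 / sqrt (2 * pi * t) * ?e * (1 - exp (- (2 * X * Y / t)))"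
    unfolding g0_factor e[symmetric] by simp
  also have "\<dots> \<le> 1 / sqrt (2 * pi * t) * ?e * ((1 - exp (- (k * (2 * X * Y / t)))) / k)"
    using assms by (intro mult_left_mono one_minus_exp_le) auto
  also have "\<dots> = k powr (- (3 / 2)) * (1 / sqrt (2 * pi * (t / k)) * ?e * (1 - exp (- (2 * X * Y / (t / k)))))"
  proof -
    have "k powr (3 / 2) = k * sqrt k"
      using assms powr_add[of k 1 "1/2"] by (simp add: powr_half_sqrt)
    moreover have "sqrt (2 * pi * (t / k)) = sqrt (2 * pi * t) / sqrt k"
      by (simp add: real_sqrt_divide)
    moreover have "k * (2 * X * Y / t) = 2 * X * Y / (t / k)" by simp
    ultimately show ?thesis
      using assms by (simp add: powr_minus_divide mult_ac)
  qed
  finally show ?thesis unfolding g0_factor .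
qed

text \<open>Replacing \<open>t\<close> by \<open>t / k\<close> and \<open>\<theta>\<close> by
  \<open>k * \<theta>\<close> divides both \<open>t - l / \<theta>\<close> and the tangential time
  by \<open>k\<close> while \<open>l\<close> is unchanged. Hence the integrands can be compared for
  each \<open>l\<close> separately, by tilting both factors.\<close>

lemma sbm_nn_density_le:
  fixes i :: "'d::finite"
  assumes "0 < a" "0 < \<theta>" "0 < t" "0 < k" "k < 1" "x \<in> half_space i" "y \<in> half_space i"
    and m: "m \<le> sbm_cost i a x y"
  shows "sbm_nn_density i a \<theta> t x y \<le>
    ennreal (k powr (- (3 / 2)) * k powr (- ((real CARD('d) - 1) / 2)) * exp (- ((1 - k) * m / t))) *
      sbm_nn_density i a (k * \<theta>) (t / k) x y"
proof -
  let ?X = "x $ i" and ?Y = "y $ i" and ?z = "tang i y - tang i x"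
  let ?c3 = "k powr (- (3 / 2))" and ?cd = "k powr (- ((real CARD('d) - 1) / 2))"
  let ?C = "?c3 * ?cd * exp (- ((1 - k) * m / t))"
  have nn: "0 \<le> ?X" "0 \<le> ?Y" using assms by (auto simp: half_space_def)
  have C: "0 \<le> ?C" by simp
  \<comment> \<open>Common to both terms: \<open>u\<close> and \<open>v\<close> are the normal and
    tangential factors, \<open>p\<close> and \<open>q\<close> their tilting exponents, whose sum
    must dominate \<open>(1 - k) * m / t\<close>.\<close>
  have tilt: "u * v \<le> ?C * (u' * v')"
    if "(1 - k) * m / t \<le> p + q" "exp p * u \<le> ?c3 * u'" "exp q * v = ?cd * v'" "0 \<le> u" "0 \<le> v" "0 \<le> u'" "0 \<le> v'"
    for p q u v u' v' :: real
  proof -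
    have "exp ((1 - k) * m / t) * (u * v) \<le> exp (p + q) * (u * v)"
      using that by (intro mult_right_mono) auto
    also have "\<dots> = (exp p * u) * (exp q * v)" by (simp add: exp_add)
    also have "\<dots> \<le> (?c3 * u') * (exp q * v)" using that by (intro mult_right_mono) auto
    also have "\<dots> = ?c3 * ?cd * (u' * v')" using that(3) by simp
    finally have "exp (- ((1 - k) * m / t)) * (exp ((1 - k) * m / t) * (u * v)) \<le>
        exp (- ((1 - k) * m / t)) * (?c3 * ?cd * (u' * v'))"
      by (intro mult_left_mono) auto
    moreover have "exp (- ((1 - k) * m / t)) * (exp ((1 - k) * m / t) * (u * v)) = u * v"
      by (simp add: exp_minus)
    moreover have "exp (- ((1 - k) * m / t)) * (?c3 * ?cd * (u' * v')) = ?C * (u' * v')"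
      by (simp only: mult_ac)
    ultimately show ?thesis by linarith
  qed
  have direct: "g0 t ?X ?Y * gauss_tang t ?z \<le> ?C * (g0 (t / k) ?X ?Y * gauss_tang (t / k) ?z)"
  proof (rule tilt)
    have "2 * m \<le> (?X - ?Y)\<^sup>2 + (norm ?z)\<^sup>2"
      using m assms nn split_cost_le_direct[of a ?X ?Y "norm ?z"] by (simp add: sbm_cost_eq_split_cost)
    then have "(1 - k) * (2 * m) / (2 * t) \<le> (1 - k) * ((?X - ?Y)\<^sup>2 + (norm ?z)\<^sup>2) / (2 * t)"
      using assms by (intro divide_right_mono mult_left_mono) auto
    then show "(1 - k) * m / t \<le> (1 - k) * (?X - ?Y)\<^sup>2 / (2 * t) + (1 - k) * (norm ?z)\<^sup>2 / (2 * t)"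
      by (simp add: distrib_left add_divide_distrib)
  qed (use assms nn in \<open>auto intro: g0_tilt gauss_tang_tilt g0_nonneg gauss_tang_nonneg\<close>)
  have boundary: "hit_density (t - l / \<theta>) (l + ?X + ?Y) * gauss_tang (t + (a - 1) * (l / \<theta>)) ?z \<le>
      ?C * (hit_density (t / k - l / (k * \<theta>)) (l + ?X + ?Y) * gauss_tang (t / k + (a - 1) * (l / (k * \<theta>))) ?z)"
    if l: "0 < l" "l < \<theta> * t" for l
  proof -
    define s where "s = t - l / \<theta>"
    define u where "u = t + (a - 1) * (l / \<theta>)"
    \<comment> \<open>The fraction of the time \<open>t\<close> spent on the boundary.\<close>
    define \<tau> where "\<tau> = l / (\<theta> * t)"
    have \<tau>: "0 \<le> \<tau>" "\<tau> < 1" using l assms by (simp_all add: \<tau>_def)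
    have s: "0 < s" "s = t * (1 - \<tau>)" using l assms by (simp_all add: s_def \<tau>_def field_simps)
    have u: "0 < u" unfolding u_def using l assms by (intro tangential_time_pos) (simp_all add: field_simps)
    have u_eq: "u = t * (1 + (a - 1) * \<tau>)" using l assms by (simp add: u_def \<tau>_def field_simps)
    have "2 * m \<le> (?X + ?Y)\<^sup>2 / (1 - \<tau>) + (norm ?z)\<^sup>2 / (1 + (a - 1) * \<tau>)"
      using m assms nn \<tau> split_cost_le_boundary[of a ?X ?Y "norm ?z" \<tau>] by (simp add: sbm_cost_eq_split_cost)
    \<comment> \<open>For the upper bound the shift by \<open>l\<close> is harmless: it only
      increases the exponent.\<close>
    also have "\<dots> \<le> (l + ?X + ?Y)\<^sup>2 / (1 - \<tau>) + (norm ?z)\<^sup>2 / (1 + (a - 1) * \<tau>)"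
      using l nn \<tau> by (intro add_right_mono divide_right_mono power_mono) auto
    finally have "(1 - k) * (2 * m) / (2 * t) \<le>
        (1 - k) * ((l + ?X + ?Y)\<^sup>2 / (1 - \<tau>) + (norm ?z)\<^sup>2 / (1 + (a - 1) * \<tau>)) / (2 * t)"
      using assms by (intro divide_right_mono mult_left_mono) auto
    also have "(1 - k) * (2 * m) / (2 * t) = (1 - k) * m / t" by simp
    also have "(1 - k) * ((l + ?X + ?Y)\<^sup>2 / (1 - \<tau>) + (norm ?z)\<^sup>2 / (1 + (a - 1) * \<tau>)) / (2 * t) =
        (1 - k) * (l + ?X + ?Y)\<^sup>2 / (2 * s) + (1 - k) * (norm ?z)\<^sup>2 / (2 * u)"
      unfolding s(2) u_eq by (simp add: distrib_left add_divide_distrib mult_ac)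
    finally have le: "(1 - k) * m / t \<le>
        (1 - k) * (l + ?X + ?Y)\<^sup>2 / (2 * s) + (1 - k) * (norm ?z)\<^sup>2 / (2 * u)" .
    have "t / k - l / (k * \<theta>) = s / k" "t / k + (a - 1) * (l / (k * \<theta>)) = u / k"
      using assms by (simp_all add: s_def u_def field_simps)
    moreover have "hit_density s (l + ?X + ?Y) * gauss_tang u ?z \<le>
        ?C * (hit_density (s / k) (l + ?X + ?Y) * gauss_tang (u / k) ?z)"
      by (rule tilt[OF le])
         (use assms s u hit_density_tilt[of s k] in \<open>auto intro: gauss_tang_tilt hit_density_nonneg gauss_tang_nonneg\<close>)
    ultimately show ?thesis by (simp only: s_def[symmetric] u_def[symmetric])
  qed
  let ?N = "\<lambda>\<theta> t. \<integral>\<^sup>+l. ennreal (hit_density (t - l / \<theta>) (l + ?X + ?Y) *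
            gauss_tang (t + (a - 1) * (l / \<theta>)) ?z) * indicator {0..\<theta> * t} l \<partial>lborel"
  have "?N \<theta> t \<le> (\<integral>\<^sup>+l. ennreal ?C * (ennreal (hit_density (t / k - l / (k * \<theta>)) (l + ?X + ?Y) *
            gauss_tang (t / k + (a - 1) * (l / (k * \<theta>))) ?z) * indicator {0..k * \<theta> * (t / k)} l) \<partial>lborel)"
  proof (rule nn_integral_mono_AE)
    have *: "ennreal (hit_density (t - l / \<theta>) (l + ?X + ?Y) * gauss_tang (t + (a - 1) * (l / \<theta>)) ?z) * indicator {0..\<theta> * t} l
        \<le> ennreal ?C * (ennreal (hit_density (t / k - l / (k * \<theta>)) (l + ?X + ?Y) *
            gauss_tang (t / k + (a - 1) * (l / (k * \<theta>))) ?z) * indicator {0..k * \<theta> * (t / k)} l)"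
      if "l \<noteq> 0" "l \<noteq> \<theta> * t" for l
    proof (cases "0 < l \<and> l < \<theta> * t")
      case True
      \<comment> \<open>The range of \<open>l\<close> is the same for both densities.\<close>
      have "k * \<theta> * (t / k) = \<theta> * t" using assms by simp
      then show ?thesis
        using True ennreal_leI[OF boundary[of l]] C by (simp add: ennreal_mult')
    qed (use that in \<open>auto split: split_indicator\<close>)
    show "AE l in lborel. ennreal (hit_density (t - l / \<theta>) (l + ?X + ?Y) * gauss_tang (t + (a - 1) * (l / \<theta>)) ?z) * indicator {0..\<theta> * t} l
        \<le> ennreal ?C * (ennreal (hit_density (t / k - l / (k * \<theta>)) (l + ?X + ?Y) *
            gauss_tang (t / k + (a - 1) * (l / (k * \<theta>))) ?z) * indicator {0..k * \<theta> * (t / k)} l)"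
      using AE_lborel_singleton[of 0] AE_lborel_singleton[of "\<theta> * t"]
      by eventually_elim (rule *)
  qed
  also have "\<dots> = ennreal ?C * ?N (k * \<theta>) (t / k)"
    by (rule nn_integral_cmult) measurable
  finally have "2 * ?N \<theta> t \<le> 2 * (ennreal ?C * ?N (k * \<theta>) (t / k))"
    by (rule mult_left_mono) simp
  moreover have "ennreal (g0 t ?X ?Y * gauss_tang t ?z) \<le> ennreal ?C * ennreal (g0 (t / k) ?X ?Y * gauss_tang (t / k) ?z)"
    using ennreal_leI[OF direct] C by (simp only: ennreal_mult')
  ultimately show ?thesis
    unfolding sbm_nn_density_def by (simp only: distrib_left add_mono mult.left_commute[of 2])
qed

lemma prob_space_sbm_kernel:
  fixes i :: "'d::finite"
  assumes "0 < a" "0 < \<theta>" "0 < t" "x \<in> half_space i"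
  shows "prob_space (sbm_kernel i a \<theta> t x)"
proof
  have "emeasure (sbm_kernel i a \<theta> t x) (space (sbm_kernel i a \<theta> t x)) =
      (\<integral>\<^sup>+y. sbm_nn_density i a \<theta> t x y * indicator (space (sticky_measure i \<theta>)) y \<partial>sticky_measure i \<theta>)"
    using assms by (simp add: sbm_kernel_eq emeasure_density measurable_sticky_measure)
  also have "\<dots> = (\<integral>\<^sup>+y. sbm_nn_density i a \<theta> t x y \<partial>sticky_measure i \<theta>)"
    by (intro nn_integral_cong) simp
  finally show "emeasure (sbm_kernel i a \<theta> t x) (space (sbm_kernel i a \<theta> t x)) = 1"
    using assms by (simp add: nn_integral_sbm_nn_density_eq_1)
qed

lemma sets_sbm_kernel: "sets (sbm_kernel i a \<theta> t x) = sets (restrict_space borel (half_space i))"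
  by (simp add: sbm_kernel_def sets_sticky_measure)

text \<open>Chebyshev's inequality: the tilted density has stickiness
  \<open>k * \<theta> \<le> \<theta>\<close> and therefore mass at most one under the measure of
  stickiness \<open>\<theta>\<close>.\<close>

lemma emeasure_sbm_kernel_le:
  fixes i :: "'d::finite"
  assumes "0 < a" "0 < \<theta>" "0 < t" "0 < k" "k < 1" "x \<in> half_space i"
    and E: "E \<in> sets (restrict_space borel (half_space i))"
    and m: "\<And>y. y \<in> E \<Longrightarrow> m \<le> sbm_cost i a x y"
  shows "emeasure (sbm_kernel i a \<theta> t x) E \<le>
    ennreal (k powr (- (3 / 2)) * k powr (- ((real CARD('d) - 1) / 2)) * exp (- ((1 - k) * m / t)))"
    (is "_ \<le> ennreal ?C")
proof -
  have sub: "E \<subseteq> half_space i" using sets.sets_into_space[OF E] by (simp add: space_restrict_space)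
  have "emeasure (sbm_kernel i a \<theta> t x) E = (\<integral>\<^sup>+y. sbm_nn_density i a \<theta> t x y * indicator E y \<partial>sticky_measure i \<theta>)"
    using assms by (simp add: sbm_kernel_eq emeasure_density measurable_sticky_measure sets_sticky_measure)
  also have "\<dots> \<le> (\<integral>\<^sup>+y. ennreal ?C * sbm_nn_density i a (k * \<theta>) (t / k) x y \<partial>sticky_measure i \<theta>)"
  proof (rule nn_integral_mono)
    fix y
    show "sbm_nn_density i a \<theta> t x y * indicator E y \<le> ennreal ?C * sbm_nn_density i a (k * \<theta>) (t / k) x y"
      using sbm_nn_density_le[of a \<theta> t k x i y m] assms sub m by (cases "y \<in> E") auto
  qed
  also have "\<dots> = ennreal ?C * (\<integral>\<^sup>+y. sbm_nn_density i a (k * \<theta>) (t / k) x y \<partial>sticky_measure i \<theta>)"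
    by (intro nn_integral_cmult measurable_sticky_measure) measurable
  also have "\<dots> \<le> ennreal ?C * 1"
    using assms by (intro mult_left_mono nn_integral_sbm_nn_density_le_1) auto
  finally show ?thesis by simp
qed

subsection \<open>Lower bound\<close>

text \<open>The condition \<open>r \<le> y $ i\<close> keeps the open box inside the half-space and
  away from the atom, so its measure is its Lebesgue volume.\<close>

lemma emeasure_sticky_box:
  fixes i :: "'d::finite"
  assumes "0 < r" "r \<le> y $ i"
  shows "(\<integral>\<^sup>+w. indicator {w. \<forall>j. \<bar>w $ j - y $ j\<bar> < r} w \<partial>sticky_measure i \<theta>) = ennreal ((2 * r) ^ CARD('d))"
proof -
  define f :: "'d \<Rightarrow> real \<Rightarrow> ennreal" where "f = (\<lambda>j. indicator {y $ j - r<..<y $ j + r})"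
  have [measurable]: "f j \<in> borel_measurable borel" for j by (simp add: f_def)
  have "indicator {w. \<forall>j. \<bar>w $ j - y $ j\<bar> < r} w = (\<Prod>j\<in>UNIV. f j (w $ j))" for w
  proof (cases "\<forall>j. \<bar>w $ j - y $ j\<bar> < r")
    case True
    have "f j (w $ j) = 1" for j
      using True[rule_format, of j] by (auto simp: f_def abs_less_iff)
    then show ?thesis using True by simp
  next
    case False
    then obtain j where "\<not> \<bar>w $ j - y $ j\<bar> < r" by auto
    then have "f j (w $ j) = 0" by (auto simp: f_def indicator_def)
    then have "(\<Prod>j\<in>UNIV. f j (w $ j)) = 0" by (intro prod_zero) auto
    then show ?thesis using False by simp
  qed
  then have "(\<integral>\<^sup>+w. indicator {w. \<forall>j. \<bar>w $ j - y $ j\<bar> < r} w \<partial>sticky_measure i \<theta>) =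
      ((\<integral>\<^sup>+v. f i v * indicator {0..} v \<partial>lborel) + ennreal (1 / (2 * \<theta>)) * f i 0) *
      (\<Prod>j\<in>UNIV - {i}. \<integral>\<^sup>+v. f j v \<partial>lborel)"
    by (simp add: nn_integral_sticky_measure_prod)
  also have "f i 0 = 0" using assms by (simp add: f_def)
  also have "(\<integral>\<^sup>+v. f i v * indicator {0..} v \<partial>lborel) = (\<integral>\<^sup>+v. f i v \<partial>lborel)"
    using assms by (intro nn_integral_cong) (auto simp: f_def split: split_indicator)
  also have "((\<integral>\<^sup>+v. f i v \<partial>lborel) + ennreal (1 / (2 * \<theta>)) * 0) *
      (\<Prod>j\<in>UNIV - {i}. \<integral>\<^sup>+v. f j v \<partial>lborel) = ennreal (2 * r) ^ CARD('d)"
  proof -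
    have f: "(\<integral>\<^sup>+v. f j v \<partial>lborel) = ennreal (2 * r)" for j
      using assms by (simp add: f_def)
    have n: "CARD('d) = Suc (card (UNIV - {i}))" by (rule card.remove) auto
    show ?thesis
      unfolding n power_Suc f by (simp only: mult_zero_right add_0_right prod_constant)
  qed
  also have "\<dots> = ennreal ((2 * r) ^ CARD('d))"
    using assms by (simp add: ennreal_power)
  finally show ?thesis .
qed

text \<open>Here and in the next two lemmas the prefactor is replaced by a constant independent of
  \<open>t\<close>, so that only the Gaussian exponent remains.\<close>

lemma gauss_tang_ge:
  fixes z :: "real ^ 'd::finite"
  assumes "0 < t" "t \<le> T"
  shows "1 / (2 * pi * T) powr ((real CARD('d) - 1) / 2) * exp (- ((norm z)\<^sup>2 / (2 * t))) \<le> gauss_tang t z"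
proof -
  have "0 < CARD('d)" by simp
  then have "0 \<le> (real CARD('d) - 1) / 2" by simp
  then have "(2 * pi * t) powr ((real CARD('d) - 1) / 2) \<le> (2 * pi * T) powr ((real CARD('d) - 1) / 2)"
    using assms by (intro powr_mono2) auto
  then show ?thesis
    unfolding gauss_tang_def using assms by (intro mult_right_mono divide_left_mono) auto
qed

lemma hit_density_ge:
  assumes "0 < t" "t \<le> 1" "0 \<le> b" "b \<le> r"
  shows "b / sqrt (2 * pi) * exp (- (r\<^sup>2 / (2 * t))) \<le> hit_density t r"
proof -
  have "0 < t powr (3 / 2)" "t powr (3 / 2) \<le> 1"
    using assms powr_mono2[of "3 / 2" t 1] by auto
  then have "b / (sqrt (2 * pi) * 1) \<le> r / (sqrt (2 * pi) * t powr (3 / 2))"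
    using assms by (intro frac_le) auto
  then show ?thesis
    unfolding hit_density_def using assms by (intro mult_right_mono) auto
qed

text \<open>For \<open>t \<le> 1\<close> and \<open>Y \<ge> b\<close> the factor
  \<open>1 - exp (- (2 * X * Y / t))\<close> is smallest at \<open>t = 1\<close>,
  \<open>Y = b\<close>, where it is positive because \<open>X\<close> and \<open>b\<close>
  are.\<close>

lemma g0_ge:
  assumes "0 < t" "t \<le> 1" "0 < X" "0 < b" "b \<le> Y"
  shows "(1 - exp (- (2 * X * b))) / sqrt (2 * pi) * exp (- ((X - Y)\<^sup>2 / (2 * t))) \<le> g0 t X Y"
proof -
  have "2 * X * b \<le> 2 * X * Y / t"
  proof -
    have "2 * X * b * t \<le> 2 * X * Y * 1" using assms by (intro mult_mono) auto
    then show ?thesis using assms by (simp add: field_simps)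
  qed
  then have "1 - exp (- (2 * X * b)) \<le> 1 - exp (- (2 * X * Y / t))" by simp
  moreover have "1 / sqrt (2 * pi) \<le> 1 / sqrt (2 * pi * t)"
    using assms by (intro divide_left_mono) auto
  ultimately have "(1 / sqrt (2 * pi)) * (1 - exp (- (2 * X * b))) \<le>
      (1 / sqrt (2 * pi * t)) * (1 - exp (- (2 * X * Y / t)))"
    using assms by (intro mult_mono) auto
  then have "(1 / sqrt (2 * pi)) * (1 - exp (- (2 * X * b))) * exp (- ((X - Y)\<^sup>2 / (2 * t))) \<le>
      (1 / sqrt (2 * pi * t)) * (1 - exp (- (2 * X * Y / t))) * exp (- ((X - Y)\<^sup>2 / (2 * t)))"
    by (intro mult_right_mono) auto
  then show ?thesis unfolding g0_factor by (simp add: mult_ac)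
qed

lemma eventually_nhds_less_isCont:
  fixes f :: "'a::t2_space \<Rightarrow> real"
  assumes "isCont f x" "f x < c"
  shows "\<forall>\<^sub>F y in nhds x. f y < c"
  using assms unfolding isCont_def tendsto_at_iff_tendsto_nhds by (rule order_tendstoD(2))

text \<open>The strict inequality below \<open>V\<close> persists on a ball around \<open>y\<close>.
  The factor \<open>t < 1\<close> is inserted to give the same form of bound as for the boundary
  term.\<close>

lemma sbm_nn_density_ge_direct:
  fixes i :: "'d::finite"
  assumes "0 < a" "0 < \<theta>" "x \<in> half_space i" "0 < x $ i" "0 < y $ i"
    and V: "(x $ i - y $ i)\<^sup>2 + (norm (tang i y - tang i x))\<^sup>2 < V"
  shows "\<exists>K>0. \<exists>d>0. \<exists>t0>0. \<forall>t w. 0 < t \<longrightarrow> t < t0 \<longrightarrow> dist w y < d \<longrightarrow>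
    ennreal (K * t * exp (- (V / (2 * t)))) \<le> sbm_nn_density i a \<theta> t x w"
proof -
  let ?D = "\<lambda>w. (x $ i - w $ i)\<^sup>2 + (norm (tang i w - tang i x))\<^sup>2"
  have "continuous_on UNIV ?D" by (intro continuous_intros continuous_on_component)
  then have "isCont ?D y" by (simp add: continuous_on_eq_continuous_at)
  then have "\<forall>\<^sub>F w in nhds y. ?D w < V"
    using V by (rule eventually_nhds_less_isCont)
  moreover have "\<forall>\<^sub>F w in nhds y. y $ i / 2 < w $ i"
    using eventually_nhds_less_isCont[where f = "\<lambda>w. - (w $ i)" and x = y and c = "- (y $ i / 2)"] assms(5)
    by (auto intro!: continuous_intros)
  ultimately have "\<forall>\<^sub>F w in nhds y. ?D w < V \<and> y $ i / 2 < w $ i" by (rule eventually_conj)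
  then obtain d where d: "0 < d" "\<And>w. dist w y < d \<Longrightarrow> ?D w < V \<and> y $ i / 2 < w $ i"
    unfolding eventually_nhds_metric by blast
  define b where "b = y $ i / 2"
  define K0 where "K0 = (1 - exp (- (2 * (x $ i) * b))) / sqrt (2 * pi)"
  define K1 where "K1 = 1 / (2 * pi * 1) powr ((real CARD('d) - 1) / 2)"
  have b: "0 < b" using assms by (simp add: b_def)
  then have K: "0 < K0" "0 < K1" using assms by (simp_all add: K0_def K1_def)
  have "ennreal (K0 * K1 * t * exp (- (V / (2 * t)))) \<le> sbm_nn_density i a \<theta> t x w"
    if t: "0 < t" "t < 1" and w: "dist w y < d" for t w
  proof -
    let ?z = "tang i w - tang i x"
    have "K0 * K1 * t * exp (- (V / (2 * t))) \<le> K0 * K1 * 1 * exp (- (?D w / (2 * t)))"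
      using K t d(2)[OF w] by (intro mult_mono) (auto simp: divide_right_mono)
    also have "\<dots> = (K0 * exp (- ((x $ i - w $ i)\<^sup>2 / (2 * t)))) * (K1 * exp (- ((norm ?z)\<^sup>2 / (2 * t))))"
      by (simp only: add_divide_distrib minus_add_distrib exp_add mult_1_right mult_ac)
    also have "\<dots> \<le> g0 t (x $ i) (w $ i) * gauss_tang t ?z"
      unfolding K0_def K1_def
      using t b assms d(2)[OF w] K
      by (intro mult_mono g0_ge gauss_tang_ge g0_nonneg) (auto simp: b_def K0_def K1_def)
    finally have "ennreal (K0 * K1 * t * exp (- (V / (2 * t)))) \<le> ennreal (g0 t (x $ i) (w $ i) * gauss_tang t ?z)"
      by (rule ennreal_leI)
    also have "\<dots> \<le> sbm_nn_density i a \<theta> t x w"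
      unfolding sbm_nn_density_def by simp
    finally show ?thesis .
  qed
  then show ?thesis using K d(1)
    by (intro exI[of _ "K0 * K1"] conjI exI[of _ d] exI[of _ 1]) auto
qed

text \<open>The integral is restricted to \<open>l = \<theta> * t * \<tau>'\<close> with
  \<open>\<tau>'\<close> between \<open>\<tau>\<close> and \<open>\<tau> + d / 2\<close>; the length
  of this range is the origin of the factor \<open>t\<close>.\<close>

lemma sbm_nn_density_ge_boundary:
  fixes i :: "'d::finite"
  assumes "0 < a" "0 < \<theta>" "x \<in> half_space i" "0 < y $ i" "0 < \<tau>" "\<tau> < 1"
    and V: "(x $ i + y $ i)\<^sup>2 / (1 - \<tau>) + (norm (tang i y - tang i x))\<^sup>2 / (1 + (a - 1) * \<tau>) < V"
  shows "\<exists>K>0. \<exists>d>0. \<exists>t0>0. \<forall>t w. 0 < t \<longrightarrow> t < t0 \<longrightarrow> dist w y < d \<longrightarrow>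
    ennreal (K * t * exp (- (V / (2 * t)))) \<le> sbm_nn_density i a \<theta> t x w"
proof -
  let ?X = "x $ i" and ?z = "\<lambda>w. tang i w - tang i x"
  \<comment> \<open>The shift \<open>l\<close> and the fraction \<open>\<tau>'\<close> are treated
    as independent variables, so that continuity at \<open>(0, \<tau>, y)\<close> makes the shift
    negligible.\<close>
  define P where "P = (\<lambda>p. (fst p + ?X + snd (snd p) $ i)\<^sup>2 / (1 - fst (snd p)) +
      (norm (?z (snd (snd p))))\<^sup>2 / (1 + (a - 1) * fst (snd p)))"
  have x: "0 \<le> ?X" using assms by (simp add: half_space_def)
  have q: "0 < 1 + (a - 1) * \<tau>" using assms by (intro tangential_time_pos) auto
  have tang: "isCont (\<lambda>p :: real \<times> real \<times> (real ^ 'd). tang i (snd (snd p))) p" for p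
  proof -
    have "continuous_on UNIV (\<lambda>p :: real \<times> real \<times> (real ^ 'd). tang i (snd (snd p)))"
      by (intro continuous_intros)
    then show ?thesis by (simp add: continuous_on_eq_continuous_at del: split_paired_All)
  qed
  have nth: "isCont (\<lambda>p :: real \<times> real \<times> (real ^ 'd). snd (snd p) $ i) p" for p
    by (intro continuous_intros)
  have "isCont P (0, \<tau>, y)"
    unfolding P_def using assms q by (intro continuous_intros tang nth) auto
  then have "\<forall>\<^sub>F p in nhds (0, \<tau>, y). P p < V"
    using V by (intro eventually_nhds_less_isCont) (auto simp: P_def)
  moreover have "\<forall>\<^sub>F p in nhds (0 :: real, \<tau>, y). y $ i / 2 < snd (snd p) $ i"
    using eventually_nhds_less_isCont[where f = "\<lambda>p :: real \<times> real \<times> (real ^ 'd). - (snd (snd p) $ i)"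
        and x = "(0, \<tau>, y)" and c = "- (y $ i / 2)"] assms(4)
    by (auto intro!: continuous_intros)
  moreover have "\<forall>\<^sub>F p in nhds (0 :: real, \<tau>, y). fst (snd p) < 1"
    using assms by (intro eventually_nhds_less_isCont continuous_intros) auto
  ultimately have "\<forall>\<^sub>F p in nhds (0, \<tau>, y). P p < V \<and> y $ i / 2 < snd (snd p) $ i \<and> fst (snd p) < 1"
    by (intro eventually_conj)
  then obtain e where e: "0 < e" "\<And>p. dist p (0, \<tau>, y) < e \<Longrightarrow> P p < V \<and> y $ i / 2 < snd (snd p) $ i \<and> fst (snd p) < 1"
    unfolding eventually_nhds_metric by blast
  \<comment> \<open>The distance in the triple product is at most the sum of the three coordinate
    distances.\<close>
  define d where "d = e / 3"
  have d: "0 < d" using e(1) by (simp add: d_def)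
  have near: "P (\<sigma>, \<tau>', w) < V" "y $ i / 2 < w $ i" "\<tau>' < 1"
    if "\<bar>\<sigma>\<bar> < d" "\<bar>\<tau>' - \<tau>\<bar> < d" "dist w y < d" for \<sigma> \<tau>' w
  proof -
    have "dist (\<tau>', w) (\<tau>, y) \<le> \<bar>\<tau>' - \<tau>\<bar> + dist w y"
      using sqrt_sum_squares_le_sum_abs[of "\<bar>\<tau>' - \<tau>\<bar>" "dist w y"]
      by (simp add: dist_Pair_Pair dist_real_def)
    moreover have "dist (\<sigma>, \<tau>', w) (0, \<tau>, y) \<le> \<bar>\<sigma>\<bar> + dist (\<tau>', w) (\<tau>, y)"
      using sqrt_sum_squares_le_sum_abs[of "\<bar>\<sigma>\<bar>" "dist (\<tau>', w) (\<tau>, y)"]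
      by (simp add: dist_Pair_Pair dist_real_def)
    ultimately have "dist (\<sigma>, \<tau>', w) (0, \<tau>, y) < e" using that by (simp add: d_def)
    from e(2)[OF this] show "P (\<sigma>, \<tau>', w) < V" "y $ i / 2 < w $ i" "\<tau>' < 1" by simp_all
  qed
  define b where "b = y $ i / 2"
  define K0 where "K0 = b / sqrt (2 * pi)"
  \<comment> \<open>\<open>1 + a\<close> bounds the tangential time
    \<open>t * (1 + (a - 1) * \<tau>')\<close> for \<open>t \<le> 1\<close>.\<close>
  define K1 where "K1 = 1 / (2 * pi * (1 + a)) powr ((real CARD('d) - 1) / 2)"
  define K where "K = K0 * K1 * (\<theta> * (d / 2))"
  have K01: "0 < K0" "0 < K1" using assms by (simp_all add: K0_def K1_def b_def)
  have K: "0 < K" using K01 assms d by (simp add: K_def)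
  \<comment> \<open>The second entry ensures \<open>l < \<theta> * t < d\<close>.\<close>
  define t0 where "t0 = min 1 (d / \<theta>)"
  have t0: "0 < t0" using d assms by (simp add: t0_def)
  have "ennreal (K * t * exp (- (V / (2 * t)))) \<le> sbm_nn_density i a \<theta> t x w"
    if t: "0 < t" "t < t0" and w: "dist w y < d" for t w
  proof -
    define c where "c = K0 * K1 * exp (- (V / (2 * t)))"
    have c: "0 \<le> c" using K01 by (simp add: c_def)
    let ?k = "\<lambda>l. hit_density (t - l / \<theta>) (l + ?X + w $ i) * gauss_tang (t + (a - 1) * (l / \<theta>)) (?z w)"
    let ?l0 = "\<theta> * t * \<tau>" and ?l1 = "\<theta> * t * (\<tau> + d / 2)"
    have t1: "t \<le> 1" "\<theta> * t < d" using t assms by (simp_all add: t0_def field_simps)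
    have *: "l \<le> \<theta> * t \<and> c \<le> ?k l" if l: "?l0 \<le> l" "l \<le> ?l1" for l
    proof -
      define \<tau>' where "\<tau>' = l / (\<theta> * t)"
      have l_eq: "l = \<theta> * t * \<tau>'" using assms t by (simp add: \<tau>'_def)
      have \<tau>'1: "\<tau> \<le> \<tau>'" "\<tau>' \<le> \<tau> + d / 2" using l assms t unfolding l_eq by simp_all
      then have \<tau>'d: "\<bar>\<tau>' - \<tau>\<bar> < d" using d by simp
      have \<tau>': "0 < \<tau>'" "\<tau>' < 1" using \<tau>'1 assms near(3)[OF _ \<tau>'d w, of 0] d by auto
      have ld: "0 < l" "l < \<theta> * t" using assms t \<tau>' by (simp_all add: l_eq)
      then have "\<bar>l\<bar> < d" using t1 by simp
      note nr = near[OF this \<tau>'d w]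
      have s_eq: "t - l / \<theta> = t * (1 - \<tau>')" using assms by (simp add: l_eq algebra_simps)
      have u_eq: "t + (a - 1) * (l / \<theta>) = t * (1 + (a - 1) * \<tau>')" using assms by (simp add: l_eq algebra_simps)
      have q': "0 < 1 + (a - 1) * \<tau>'" using assms \<tau>' by (intro tangential_time_pos) auto
      have "c \<le> K0 * K1 * exp (- (P (l, \<tau>', w) / (2 * t)))"
        unfolding c_def using nr(1) t K01 by (intro mult_left_mono) (auto simp: divide_right_mono)
      also have "P (l, \<tau>', w) / (2 * t) = (l + ?X + w $ i)\<^sup>2 / (2 * (t - l / \<theta>)) + (norm (?z w))\<^sup>2 / (2 * (t + (a - 1) * (l / \<theta>)))"
        unfolding s_eq u_eq P_def by (simp add: add_divide_distrib mult_ac)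
      also have "K0 * K1 * exp (- \<dots>) =
          (K0 * exp (- ((l + ?X + w $ i)\<^sup>2 / (2 * (t - l / \<theta>))))) *
          (K1 * exp (- ((norm (?z w))\<^sup>2 / (2 * (t + (a - 1) * (l / \<theta>))))))"
        by (simp only: minus_add_distrib exp_add mult_ac)
      also have "\<dots> \<le> ?k l"
      proof (intro mult_mono)
        have "t * (1 - \<tau>') \<le> 1 * 1" using t t1 \<tau>' by (intro mult_mono) auto
        then show "K0 * exp (- ((l + ?X + w $ i)\<^sup>2 / (2 * (t - l / \<theta>)))) \<le> hit_density (t - l / \<theta>) (l + ?X + w $ i)"
          unfolding K0_def s_eq using t \<tau>' ld x nr(2) assms
          by (intro hit_density_ge) (auto simp: b_def)
        have "(a - 1) * \<tau>' \<le> a"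
        proof -
          have "a * \<tau>' \<le> a * 1" using assms \<tau>' by (intro mult_left_mono) auto
          then show ?thesis using \<tau>' by (simp add: algebra_simps)
        qed
        then have "t * (1 + (a - 1) * \<tau>') \<le> 1 * (1 + a)" using t t1 q' by (intro mult_mono) auto
        then show "K1 * exp (- ((norm (?z w))\<^sup>2 / (2 * (t + (a - 1) * (l / \<theta>))))) \<le>
            gauss_tang (t + (a - 1) * (l / \<theta>)) (?z w)"
          unfolding K1_def u_eq using t q' by (intro gauss_tang_ge) auto
      qed (use K01 in \<open>auto simp: hit_density_nonneg\<close>)
      finally show ?thesis using ld by simp
    qed
    have "ennreal (K * t * exp (- (V / (2 * t)))) = ennreal c * ennreal (?l1 - ?l0)"
      using c assms t d by (subst ennreal_mult[symmetric]) (auto simp: K_def c_def algebra_simps)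
    also have "\<dots> = ennreal c * emeasure lborel {?l0..?l1}"
      using assms t d by (subst emeasure_lborel_Icc) auto
    also have "\<dots> = (\<integral>\<^sup>+l. ennreal c * indicator {?l0..?l1} l \<partial>lborel)"
      by (simp add: nn_integral_cmult_indicator)
    also have "\<dots> \<le> (\<integral>\<^sup>+l. ennreal (?k l) * indicator {0..\<theta> * t} l \<partial>lborel)"
    proof (rule nn_integral_mono)
      fix l
      show "ennreal c * indicator {?l0..?l1} l \<le> ennreal (?k l) * indicator {0..\<theta> * t} l"
      proof (cases "?l0 \<le> l \<and> l \<le> ?l1")
        case True
        moreover have "0 \<le> ?l0" using assms t by simp
        ultimately show ?thesis using *[of l] by (auto intro: ennreal_leI)
      qed auto
    qed
    also have "\<dots> \<le> 2 * \<dots>" by (simp add: mult_2)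
    also have "\<dots> \<le> sbm_nn_density i a \<theta> t x w"
      unfolding sbm_nn_density_def by simp
    finally show ?thesis .
  qed
  then show ?thesis using K d t0
    by (intro exI[of _ K] conjI exI[of _ d] exI[of _ t0]) auto
qed

lemma sbm_nn_density_ge:
  fixes i :: "'d::finite"
  assumes "0 < a" "0 < \<theta>" "x \<in> half_space i" "0 < y $ i" "0 < \<eta>"
  shows "\<exists>K>0. \<exists>d>0. \<exists>t0>0. \<forall>t w. 0 < t \<longrightarrow> t < t0 \<longrightarrow> dist w y < d \<longrightarrow>
    ennreal (K * t * exp (- ((sbm_cost i a x y + \<eta>) / t))) \<le> sbm_nn_density i a \<theta> t x w"
proof -
  let ?X = "x $ i" and ?Y = "y $ i" and ?Z = "norm (tang i y - tang i x)"
  define V where "V = 2 * sbm_cost i a x y + 2 * \<eta>"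
  have x: "0 \<le> ?X" and y: "y \<in> half_space i" using assms by (auto simp: half_space_def)
  have c: "sbm_cost i a x y = split_cost a ?X ?Y ?Z"
    using assms y by (simp add: sbm_cost_eq_split_cost)
  have V: "V / (2 * t) = (sbm_cost i a x y + \<eta>) / t" for t
    by (cases "t = 0") (simp_all add: V_def field_simps)
  have "0 < 2 * \<eta>" using assms by simp
  with assms(1) x assms(4) norm_ge_zero show ?thesis
  proof (cases rule: split_cost_attained[of a ?X ?Y ?Z "2 * \<eta>"])
    case direct
    then show ?thesis
      using sbm_nn_density_ge_direct[of a \<theta> x i y V] assms by (simp add: V c[symmetric]) (simp add: V_def)
  next
    case (boundary \<tau>)
    then show ?thesis
      using sbm_nn_density_ge_boundary[of a \<theta> x i y \<tau> V] assms by (simp add: V c[symmetric]) (simp add: V_def)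
  qed
qed

lemma emeasure_sbm_kernel_ge:
  fixes i :: "'d::finite"
  assumes "0 < a" "0 < \<theta>" "x \<in> half_space i" "0 < y $ i" "0 < \<eta>"
    and E: "E \<in> sets (restrict_space borel (half_space i))"
    and U: "open U" "y \<in> U" "U \<inter> half_space i \<subseteq> E"
  shows "\<exists>K>0. \<forall>\<^sub>F t in at_right 0.
    ennreal (K * t * exp (- ((sbm_cost i a x y + \<eta>) / t))) \<le> emeasure (sbm_kernel i a \<theta> t x) E"
proof -
  obtain K d t0 where K: "0 < K" "0 < d" "0 < t0"
    and q: "\<And>t w. 0 < t \<Longrightarrow> t < t0 \<Longrightarrow> dist w y < d \<Longrightarrow>
      ennreal (K * t * exp (- ((sbm_cost i a x y + \<eta>) / t))) \<le> sbm_nn_density i a \<theta> t x w"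
    using sbm_nn_density_ge[of a \<theta> x i y \<eta>] assms by blast
  obtain e where e: "0 < e" "ball y e \<subseteq> U" using U by (auto simp: open_contains_ball)
  define n where "n = real CARD('d)"
  have n: "0 < n" by (simp add: n_def)
  \<comment> \<open>The Euclidean norm is at most the sum of the \<open>n\<close> coordinates, so
    the box of half-width \<open>r\<close> lies in both balls; \<open>r \<le> y $ i\<close> keeps it
    in the half-space.\<close>
  define r where "r = min (y $ i) (min d e / (2 * n))"
  have r: "0 < r" "r \<le> y $ i" "r \<le> min d e / (2 * n)" using assms K e n by (auto simp: r_def)
  define B where "B = {w. \<forall>j. \<bar>w $ j - y $ j\<bar> < r}"
  have near: "dist w y < min d e" if "w \<in> B" for w
  proof -
    have "dist w y \<le> (\<Sum>j\<in>UNIV. \<bar>(w - y) $ j\<bar>)"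
      unfolding dist_norm by (rule norm_le_l1_cart)
    also have "\<dots> \<le> (\<Sum>j\<in>(UNIV :: 'd set). r)"
      using that by (intro sum_mono) (auto simp: B_def intro: less_imp_le)
    also have "\<dots> = n * r" by (simp add: n_def)
    also have "\<dots> \<le> min d e / 2" using r(3) n by (simp add: field_simps)
    also have "\<dots> < min d e"
    proof -
      have "0 < min d e" using K e by simp
      then show ?thesis by linarith
    qed
    finally show ?thesis .
  qed
  have BE: "B \<subseteq> E"
  proof
    fix w assume w: "w \<in> B"
    then have "w \<in> U" using near[OF w] e by (auto simp: dist_commute)
    moreover have "\<bar>w $ i - y $ i\<bar> < r" using w by (simp add: B_def)
    then have "\<bar>w $ i - y $ i\<bar> < y $ i" using r(2) by linarith
    then have "w \<in> half_space i" by (simp add: half_space_def)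
    ultimately show "w \<in> E" using U by auto
  qed
  define v where "v = (2 * r) ^ CARD('d)"
  have v: "0 < v" using r by (simp add: v_def)
  have "ennreal (v * K * t * exp (- ((sbm_cost i a x y + \<eta>) / t))) \<le> emeasure (sbm_kernel i a \<theta> t x) E"
    if t: "0 < t" "t < t0" for t
  proof -
    let ?c = "K * t * exp (- ((sbm_cost i a x y + \<eta>) / t))"
    have c: "0 \<le> ?c" using K t by simp
    have "ennreal (v * K * t * exp (- ((sbm_cost i a x y + \<eta>) / t))) = ennreal ?c * ennreal v"
      using c v by (simp add: mult_ac flip: ennreal_mult)
    also have "\<dots> = ennreal ?c * (\<integral>\<^sup>+w. indicator B w \<partial>sticky_measure i \<theta>)"
      using emeasure_sticky_box[of r y i \<theta>] r by (simp add: B_def v_def)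
    also have "\<dots> = (\<integral>\<^sup>+w. ennreal ?c * indicator B w \<partial>sticky_measure i \<theta>)"
    proof (rule nn_integral_cmult[symmetric])
      have "B \<in> sets borel" unfolding B_def by measurable
      then show "(\<lambda>w. indicator B w :: ennreal) \<in> borel_measurable (sticky_measure i \<theta>)"
        by (intro measurable_sticky_measure) simp
    qed
    also have "\<dots> \<le> (\<integral>\<^sup>+w. sbm_nn_density i a \<theta> t x w * indicator E w \<partial>sticky_measure i \<theta>)"
      using q[OF t] near BE by (intro nn_integral_mono) (auto split: split_indicator)
    also have "\<dots> = emeasure (sbm_kernel i a \<theta> t x) E"
      using assms t by (simp add: sbm_kernel_eq emeasure_density measurable_sticky_measure sets_sticky_measure)
    finally show ?thesis .
  qed
  then show ?thesis
    using K v by (intro exI[of _ "v * K"] conjI) (auto simp: eventually_at_right_field intro!: exI[of _ t0])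
qed

subsection \<open>The large deviation principle\<close>

lemma elog_ge: "0 < r \<Longrightarrow> r \<le> s \<Longrightarrow> ereal (ln r) \<le> elog s"
  by (simp add: elog_def)

lemma elog_le: "0 < r \<Longrightarrow> s \<le> r \<Longrightarrow> elog s \<le> ereal (ln r)"
  by (simp add: elog_def)

text \<open>The density bound needs a positive normal coordinate, but \<open>y\<close> may lie on
  the boundary. It is therefore pushed inwards along \<open>axis i 1\<close>, staying in
  \<open>U\<close> and changing the continuous cost only slightly.\<close>

lemma Liminf_sbm_kernel_ge:
  fixes i :: "'d::finite"
  assumes "0 < a" "0 < \<theta>" "x \<in> half_space i"
    and E: "E \<in> sets (restrict_space borel (half_space i))"
    and y: "y \<in> top_of_set (half_space i) interior_of E"
  shows "ereal (- sbm_cost i a x y) \<le> Liminf (at_right 0) (\<lambda>t. ereal t * elog (measure (sbm_kernel i a \<theta> t x) E))"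
    (is "_ \<le> ?L")
proof -
  let ?c = "sbm_cost i a x"
  obtain U where U: "open U" "y \<in> U" "y \<in> half_space i" "U \<inter> half_space i \<subseteq> E"
    using y by (auto simp: interior_of_def openin_open)
  have le: "ereal (- ?c y - e) \<le> ?L" if e: "0 < e" for e
  proof -
    define p where "p = (\<lambda>s. y + s *\<^sub>R axis i (1 :: real))"
    have p_i: "p s $ i = y $ i + s" for s by (simp add: p_def)
    have "(p \<longlongrightarrow> y + 0 *\<^sub>R axis i 1) (at_right 0)" unfolding p_def by (intro tendsto_intros)
    then have p: "(p \<longlongrightarrow> y) (at_right 0)" by simp
    have pos: "\<forall>\<^sub>F s in at_right (0::real). 0 < s" by (simp add: eventually_at_right_less)
    then have pos': "\<forall>\<^sub>F s in at_right 0. 0 < p s $ i"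
      by eventually_elim (use U in \<open>simp add: p_i half_space_def\<close>)
    then have half: "\<forall>\<^sub>F s in at_right 0. p s \<in> half_space i"
      by eventually_elim (simp add: half_space_def)
    have "((\<lambda>s. ?c (p s)) \<longlongrightarrow> ?c y) (at_right 0)"
      by (rule continuous_on_tendsto_compose[OF continuous_on_sbm_cost_right[OF assms(1,3)] p U(3) half])
    \<comment> \<open>The error \<open>e\<close> is divided into thirds: one for moving
      \<open>y\<close>, one for the slack \<open>\<eta>\<close> in the density bound, one for the
      prefactor \<open>K * t\<close>.\<close>
    then have "\<forall>\<^sub>F s in at_right 0. ?c (p s) < ?c y + e / 3"
      using that by (intro order_tendstoD(2)) auto
    moreover have "\<forall>\<^sub>F s in at_right 0. p s \<in> U"
      using p U by (intro topological_tendstoD) auto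
    ultimately have "\<forall>\<^sub>F s in at_right 0. ?c (p s) < ?c y + e / 3 \<and> p s \<in> U \<and> 0 < p s $ i"
      using pos' by eventually_elim simp
    then obtain s where s: "?c (p s) < ?c y + e / 3" "p s \<in> U" "0 < p s $ i"
      using eventually_happens[of _ "at_right (0::real)"] by auto
    define b where "b = ?c (p s) + e / 3"
    obtain K where K: "0 < K" and ge: "\<forall>\<^sub>F t in at_right 0.
        ennreal (K * t * exp (- (b / t))) \<le> emeasure (sbm_kernel i a \<theta> t x) E"
      using emeasure_sbm_kernel_ge[OF assms(1-3) s(3) _ E U(1) s(2) U(4), of "e / 3"] e
      unfolding b_def by auto
    have "((\<lambda>t. t * ln K + t * ln t) \<longlongrightarrow> 0) (at_right 0)"
      using K by real_asymp
    then have "\<forall>\<^sub>F t in at_right 0. - (e / 3) < t * ln K + t * ln t"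
      using that by (intro order_tendstoD(1)) auto
    with ge have "\<forall>\<^sub>F t in at_right 0. ereal (- ?c y - e) \<le> ereal t * elog (measure (sbm_kernel i a \<theta> t x) E)"
      using eventually_at_right_less[of 0]
    proof eventually_elim
      case (elim t)
      interpret prob_space "sbm_kernel i a \<theta> t x"
        using assms elim by (intro prob_space_sbm_kernel) auto
      have pos: "0 < K * t * exp (- (b / t))" using K elim by simp
      have "K * t * exp (- (b / t)) \<le> measure (sbm_kernel i a \<theta> t x) E"
        using elim(1) by (simp add: emeasure_eq_measure)
      then have "ereal (ln (K * t * exp (- (b / t)))) \<le> elog (measure (sbm_kernel i a \<theta> t x) E)"
        using pos by (intro elog_ge)
      then have step: "ereal t * ereal (ln (K * t * exp (- (b / t)))) \<le> ereal t * elog (measure (sbm_kernel i a \<theta> t x) E)"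
        using elim by (intro ereal_mult_left_mono) auto
      have "t * ln (K * t * exp (- (b / t))) = t * ln K + t * ln t - b"
        using K elim by (simp add: ln_mult algebra_simps)
      moreover have "- ?c y - e \<le> t * ln K + t * ln t - b"
        using elim(2) s(1) unfolding b_def by linarith
      ultimately have "ereal (- ?c y - e) \<le> ereal t * ereal (ln (K * t * exp (- (b / t))))"
        by simp
      then show ?case using step by (rule order_trans)
    qed
    then show ?thesis by (rule Liminf_bounded)
  qed
  have "ereal (- ?c y) \<le> ?L + ereal e" if "0 < e" for e
    using le[OF that] by (cases ?L) (simp_all add: algebra_simps)
  then show ?thesis by (rule ereal_le_epsilon2)
qed

text \<open>Since the infimum over the closure is below the cost on \<open>E\<close>, the
  exponential bound applies to \<open>E\<close> directly. The limit in \<open>t\<close> is taken for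
  fixed \<open>k\<close>, and a small \<open>k\<close> recovers the full rate.\<close>

lemma Limsup_sbm_kernel_le:
  fixes i :: "'d::finite"
  assumes "0 < a" "0 < \<theta>" "x \<in> half_space i"
    and E: "E \<in> sets (restrict_space borel (half_space i))"
  shows "Limsup (at_right 0) (\<lambda>t. ereal t * elog (measure (sbm_kernel i a \<theta> t x) E)) \<le>
    - (INF y \<in> top_of_set (half_space i) closure_of E. ereal (sbm_cost i a x y))"
    (is "?L \<le> - ?I")
proof (cases "E = {}")
  case True
  \<comment> \<open>The infimum over the empty set is infinite and \<open>elog 0\<close> is minus
    infinity, so both sides agree.\<close>
  have "\<forall>\<^sub>F t in at_right 0. ereal t * elog (measure (sbm_kernel i a \<theta> t x) E) \<le> - ?I"
    using eventually_at_right_less[of 0] by eventually_elim (simp add: True elog_def)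
  then show ?thesis by (rule Limsup_bounded)
next
  case False
  have sub: "E \<subseteq> half_space i" using sets.sets_into_space[OF E] by (simp add: space_restrict_space)
  have cl: "E \<subseteq> top_of_set (half_space i) closure_of E"
    using sub by (intro closure_of_subset) auto
  have "0 \<le> ?I"
  proof (rule INF_greatest)
    fix y assume "y \<in> top_of_set (half_space i) closure_of E"
    then have "y \<in> half_space i" using closure_of_subset_topspace by fastforce
    then show "0 \<le> ereal (sbm_cost i a x y)"
      using assms by (simp add: sbm_cost_eq_split_cost split_cost_nonneg)
  qed
  moreover obtain y0 where "y0 \<in> E" using False by auto
  then have "?I \<le> ereal (sbm_cost i a x y0)" using cl by (intro INF_lower) auto
  ultimately obtain M where M: "?I = ereal M" "0 \<le> M" by (cases ?I) auto
  have Mle: "M \<le> sbm_cost i a x y" if "y \<in> E" for y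
  proof -
    have "?I \<le> ereal (sbm_cost i a x y)" using that cl by (intro INF_lower) auto
    then show ?thesis using M by simp
  qed
  have "?L \<le> ereal (- M) + ereal e" if "0 < e" for e
  proof -
    \<comment> \<open>Chosen so that the lost part \<open>k * M\<close> of the rate is at most
      \<open>e / 2\<close>; \<open>M + 1\<close> avoids division by zero.\<close>
    define k where "k = min (1 / 2) (e / (2 * (M + 1)))"
    have k: "0 < k" "k < 1" using that M by (auto simp: k_def)
    have "k * M \<le> e / (2 * (M + 1)) * M" using M by (intro mult_right_mono) (auto simp: k_def)
    also have "\<dots> \<le> e / 2" using M that by (simp add: field_simps)
    finally have kM: "k * M \<le> e / 2" .
    define C where "C = k powr (- (3 / 2)) * k powr (- ((real CARD('d) - 1) / 2))"
    have C: "0 < C" using k by (simp add: C_def)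
    have "((\<lambda>t. t * ln C) \<longlongrightarrow> 0 * ln C) (at_right 0)" by (intro tendsto_intros)
    then have "\<forall>\<^sub>F t in at_right 0. t * ln C < e / 2"
      using that by (intro order_tendstoD(2)) auto
    then have "\<forall>\<^sub>F t in at_right 0. ereal t * elog (measure (sbm_kernel i a \<theta> t x) E) \<le> ereal (- M) + ereal e"
      using eventually_at_right_less[of 0]
    proof eventually_elim
      case (elim t)
      interpret prob_space "sbm_kernel i a \<theta> t x"
        using assms elim by (intro prob_space_sbm_kernel) auto
      have pos: "0 < C * exp (- ((1 - k) * M / t))" using C by simp
      have "emeasure (sbm_kernel i a \<theta> t x) E \<le> ennreal (C * exp (- ((1 - k) * M / t)))"
        unfolding C_def using assms elim k Mle by (intro emeasure_sbm_kernel_le) auto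
      then have "measure (sbm_kernel i a \<theta> t x) E \<le> C * exp (- ((1 - k) * M / t))"
        using pos by (simp add: emeasure_eq_measure)
      then have step: "ereal t * elog (measure (sbm_kernel i a \<theta> t x) E) \<le> ereal t * ereal (ln (C * exp (- ((1 - k) * M / t))))"
        using elim pos by (intro ereal_mult_left_mono elog_le) auto
      have "t * ln (C * exp (- ((1 - k) * M / t))) = t * ln C - (1 - k) * M"
        using C elim by (simp add: ln_mult right_diff_distrib)
      moreover have "t * ln C - (1 - k) * M \<le> - M + e"
        using elim(1) kM by (simp add: algebra_simps)
      ultimately have "ereal t * ereal (ln (C * exp (- ((1 - k) * M / t)))) \<le> ereal (- M) + ereal e"
        by simp
      with step show ?case by (rule order_trans)
    qed
    then show ?thesis by (rule Limsup_bounded)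
  qed
  then have "?L \<le> ereal (- M)" by (rule ereal_le_epsilon2)
  then show ?thesis using M by simp
qed

lemma LDP_sbm_kernel:
  fixes i :: "'d::finite"
  assumes "0 < a" "0 < \<theta>" "x \<in> half_space i"
  shows "LDP (half_space i) (\<lambda>t. sbm_kernel i a \<theta> t x) (\<lambda>y. ereal (sbm_cost i a x y))"
  unfolding LDP_def
proof (intro conjI allI ballI impI)
  fix E assume E: "E \<in> sets (restrict_space borel (half_space i))"
  let ?L = "Liminf (at_right 0) (\<lambda>t. ereal t * elog (measure (sbm_kernel i a \<theta> t x) E))"
  have "- ?L \<le> (INF y \<in> top_of_set (half_space i) interior_of E. ereal (sbm_cost i a x y))"
  proof (rule INF_greatest)
    fix y assume "y \<in> top_of_set (half_space i) interior_of E"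
    then show "- ?L \<le> ereal (sbm_cost i a x y)"
      using Liminf_sbm_kernel_ge[OF assms E] by (simp add: ereal_uminus_le_reorder)
  qed
  then show "- (INF y \<in> top_of_set (half_space i) interior_of E. ereal (sbm_cost i a x y)) \<le> ?L"
    by (simp add: ereal_uminus_le_reorder)
  show "?L \<le> Limsup (at_right 0) (\<lambda>t. ereal t * elog (measure (sbm_kernel i a \<theta> t x) E))"
    by (rule Liminf_le_Limsup) simp
  show "Limsup (at_right 0) (\<lambda>t. ereal t * elog (measure (sbm_kernel i a \<theta> t x) E)) \<le>
      - (INF y \<in> top_of_set (half_space i) closure_of E. ereal (sbm_cost i a x y))"
    by (rule Limsup_sbm_kernel_le[OF assms E])
qed (use assms in \<open>auto intro: prob_space_sbm_kernel good_rate_function_sbm_cost simp: sets_sbm_kernel\<close>)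

theorem theorem5p1:
  fixes i :: "'d::finite" and a \<theta> :: real
  assumes "0 < a" and "0 < \<theta>"
  shows "(\<forall>x \<in> half_space i.
            LDP (half_space i) (\<lambda>\<epsilon>. sbm_kernel i a \<theta> \<epsilon> x) (\<lambda>y. ereal (sbm_cost i a x y)))
       \<and> (\<forall>x \<in> half_space i. \<forall>y \<in> half_space i. sbm_cost i a x y = sbm_cost i a y x)
       \<and> continuous_on (half_space i \<times> half_space i) (\<lambda>(x, y). sbm_cost i a x y)"
  using LDP_sbm_kernel[OF assms] sbm_cost_commute[of i a] continuous_on_sbm_cost[OF assms(1)] by blast

end
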